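(* Let $0<H<1$ and let $X=(X(t))_{t\ge 0}$ be a fractional Brownian motion with Hurst parameter $H$. Then there is a constant $c>0$ such that, for all large enough $T$, $$ T^{-(1-H)}\,(\log T)^{-c}\;\le\;\mathbb{P}\left[\sup_{0\le t\le T}X(t)\le 1\right]\;\le\;T^{-(1-H)}\,(\log T)^{c}. $$
   Context: Fractional Brownian motion with Hurst parameter $H\in(0,1)$ is the centered Gaussian process $X$ with covariance $\mathbb{E}[X(t)X(s)]=\frac12\left(|t|^{2H}+|s|^{2H}-|t-s|^{2H}\right)$; as usual, a version with continuous paths is taken. *)

theory Defs
  imports "HOL-Probability.Probability"
begin

(* Degenerate (almost surely constant) variables count as Gaussian; they need a separate case
   because normal_density m 0 is not a probability density. *)
definition gaussian_variable :: "'a measure \<Rightarrow> ('a \<Rightarrow> real) \<Rightarrow> bool" where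
  "gaussian_variable M Y \<longleftrightarrow>
     Y \<in> borel_measurable M \<and>
     ((\<exists>m \<sigma>. \<sigma> > 0 \<and> distributed M lborel Y (normal_density m \<sigma>)) \<or>
      (\<exists>m. AE w in M. Y w = m))"

definition gaussian_process :: "'a measure \<Rightarrow> 'i set \<Rightarrow> ('i \<Rightarrow> 'a \<Rightarrow> real) \<Rightarrow> bool" where
  "gaussian_process M I X \<longleftrightarrow>
     prob_space M \<and>
     (\<forall>J a. finite J \<and> J \<subseteq> I \<longrightarrow> gaussian_variable M (\<lambda>w. \<Sum>t\<in>J. a t * X t w))"

(* Every path is required to be continuous, not just almost every one, so that path suprema over
   compact intervals are finite and measurable. *)
definition fractional_brownian_motion :: "real \<Rightarrow> 'a measure \<Rightarrow> (real \<Rightarrow> 'a \<Rightarrow> real) \<Rightarrow> bool" where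
  "fractional_brownian_motion H M X \<longleftrightarrow>
     gaussian_process M {0..} X \<and>
     (\<forall>t\<ge>0. integral\<^sup>L M (X t) = 0) \<and>
     (\<forall>t\<ge>0. \<forall>s\<ge>0. integral\<^sup>L M (\<lambda>w. X t w * X s w) =
        (\<bar>t\<bar> powr (2 * H) + \<bar>s\<bar> powr (2 * H) - \<bar>t - s\<bar> powr (2 * H)) / 2) \<and>
     (\<forall>w\<in>space M. continuous_on {0..} (\<lambda>t. X t w))"

end

theory Submission
  imports Defs "HOL-Real_Asymp.Real_Asymp"
begin

text \<open>Sample the motion on a grid of mesh \<open>h\<close> and rescale to \<open>Y k = X (h k) / h powr H\<close>.  Time
  reversal identifies the increment of \<open>\<bbbE> max {Y 0, \<dots>, Y n}\<close> with
  \<open>e n = \<bbbE> max 0 (- max {Y 1, \<dots>, Y n})\<close>.  The mean maximum is of order \<open>n powr H\<close> up to a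
  logarithm and \<open>e n\<close> decreases, so \<open>e n\<close> is of order \<open>n powr (H - 1)\<close> up to logarithms.

  Upper bound: with \<open>h powr H\<close> of order \<open>L = sqrt (log T)\<close>, staying below \<open>1\<close> means
  \<open>Y k \<le> 1 / L\<close>.  Shifting by a multiple of order \<open>1 / L\<close> of the covariance with \<open>Y 1\<close> costs only a
  constant factor and turns this into \<open>Y k \<le> - 1 / L\<close>, whose probability is at most \<open>L e n\<close>.

  Lower bound: \<open>e n\<close> is essentially at most \<open>L\<close> times the probability that \<open>Y k \<le> 0\<close> for
  \<open>1 \<le> k \<le> n\<close>, and for \<open>h\<close> a negative power of \<open>log T\<close> chaining shows that the path exceeds its
  grid values by at most \<open>1\<close> except with probability \<open>O(T powr (-2))\<close>.\<close>

section \<open>Centered Gaussian variables\<close>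

abbreviation "\<N> \<equiv> std_normal_distribution"

lemma prob_space_std_normal: "prob_space \<N>"
  by (rule prob_space_normal_density) simp

text \<open>Completing the square: tilting the standard normal density by \<open>exp (l * z)\<close>
  gives the normal density with mean \<open>l\<close>, times
  \<open>exp (l\<^sup>2 / 2)\<close>.\<close>

lemma has_integral_std_normal_exp:
  "integrable \<N> (\<lambda>z. exp (l * z))" "(LINT z|\<N>. exp (l * z)) = exp (l\<^sup>2 / 2)"
proof -
  have eq: "std_normal_density z * exp (l * z) = exp (l\<^sup>2 / 2) * normal_density l 1 z" for z
    by (simp add: normal_density_def exp_add[symmetric] power2_eq_square field_simps)
  show "integrable \<N> (\<lambda>z. exp (l * z))"
    by (subst integrable_density) (auto simp: eq)
  show "(LINT z|\<N>. exp (l * z)) = exp (l\<^sup>2 / 2)"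
    by (subst integral_density) (auto simp: eq)
qed

text \<open>Both cases of the definition have the form \<open>m + s * z\<close> with
  \<open>z\<close> standard normal and \<open>s \<ge> 0\<close>, the degenerate one with
  \<open>s = 0\<close>. The mean forces \<open>m = 0\<close> and the second moment determines
  \<open>s\<close>.\<close>

lemma gaussian_variable_distr:
  assumes "prob_space M" "gaussian_variable M Y" "integral\<^sup>L M Y = 0"
  shows "integrable M Y" "integrable M (\<lambda>w. (Y w)\<^sup>2)"
    "distr M borel Y = distr \<N> borel (\<lambda>z. sqrt (LINT w|M. (Y w)\<^sup>2) * z)"
proof -
  interpret prob_space M by fact
  interpret N: prob_space \<N> by (rule prob_space_std_normal)
  have Y[measurable]: "Y \<in> borel_measurable M"
    using assms(2) by (auto simp: gaussian_variable_def)
  have i1: "integrable \<N> (\<lambda>z. z)" and i2: "integrable \<N> (\<lambda>z. z\<^sup>2)"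
    using integrable_std_normal_distribution_moment[of 1]
      integrable_std_normal_distribution_moment[of 2] by simp_all
  have e1: "(LINT z|\<N>. z) = 0" and e2: "(LINT z|\<N>. z\<^sup>2) = 1"
    using integral_std_normal_distribution_moment_odd[of 1]
      std_normal_distribution_even_moments(1)[of 1] by simp_all
  have "\<exists>m s. s \<ge> 0 \<and> distr M borel Y = distr \<N> borel (\<lambda>z. m + s * z)"
    using assms(2) unfolding gaussian_variable_def
  proof (elim conjE disjE exE)
    fix m s :: real assume s: "s > 0" and D: "distributed M lborel Y (normal_density m s)"
    have "distributed M lborel (\<lambda>x. (Y x - m) / s) std_normal_density"
      using normal_standard_normal_convert[of s Y m] s D by auto
    then have "\<N> = distr M lborel (\<lambda>x. (Y x - m) / s)"
      by (simp add: distributed_def)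
    also have "\<dots> = distr M borel (\<lambda>x. (Y x - m) / s)"
      by (rule distr_cong) auto
    finally have *: "\<N> = distr M borel (\<lambda>x. (Y x - m) / s)" .
    have "distr \<N> borel (\<lambda>z. m + s * z) = distr M borel Y"
      unfolding * using s by (subst distr_distr) (auto simp: o_def intro!: distr_cong)
    then show ?thesis using s by (intro exI[of _ m] exI[of _ s]) simp
  next
    fix m assume ae: "AE w in M. Y w = m"
    have "distr M borel Y = distr M borel (\<lambda>_. m)"
      by (intro distr_cong_AE) (use ae in auto)
    also have "\<dots> = distr \<N> borel (\<lambda>z. m + 0 * z)"
      by (simp add: distr_const N.distr_const)
    finally show ?thesis by (intro exI[of _ m] exI[of _ 0]) simp
  qed
  then obtain m s where s: "s \<ge> 0" and D: "distr M borel Y = distr \<N> borel (\<lambda>z. m + s * z)"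
    by blast
  have tr: "integrable M (\<lambda>w. f (Y w)) \<longleftrightarrow> integrable \<N> (\<lambda>z. f (m + s * z))"
    "(LINT w|M. f (Y w)) = (LINT z|\<N>. f (m + s * z))"
    if f[measurable]: "f \<in> borel_measurable borel" for f :: "real \<Rightarrow> real"
    using integrable_distr_eq[OF Y f] integrable_distr_eq[of "\<lambda>z. m + s * z" \<N> borel f]
      integral_distr[OF Y f] integral_distr[of "\<lambda>z. m + s * z" \<N> borel f] D by simp_all
  have "(LINT z|\<N>. m + s * z) = m + s * (LINT z|\<N>. z)"
    using i1 N.prob_space by (subst Bochner_Integration.integral_add) auto
  then have "integral\<^sup>L M Y = m"
    using tr(2)[of "\<lambda>x. x"] e1 by simp
  with assms(3) have m: "m = 0" by simp
  have "integrable \<N> (\<lambda>z. m + s * z)" "integrable \<N> (\<lambda>z. (m + s * z)\<^sup>2)"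
    unfolding m add_0 power_mult_distrib
    by (intro integrable_mult_right i1 i2)+
  then show "integrable M Y" "integrable M (\<lambda>w. (Y w)\<^sup>2)"
    using tr(1)[of "\<lambda>x. x"] tr(1)[of "\<lambda>x. x\<^sup>2"] by auto
  have "(LINT z|\<N>. (m + s * z)\<^sup>2) = s\<^sup>2 * (LINT z|\<N>. z\<^sup>2)"
    unfolding m add_0 power_mult_distrib by (rule integral_mult_right_zero)
  then have "(LINT w|M. (Y w)\<^sup>2) = s\<^sup>2"
    using tr(2)[of "\<lambda>x. x\<^sup>2"] e2 by (auto simp del: Bochner_Integration.integral_mult_right_zero)
  with s D show "distr M borel Y = distr \<N> borel (\<lambda>z. sqrt (LINT w|M. (Y w)\<^sup>2) * z)"
    by (simp add: m)
qed

text \<open>Reduces integrals to the standard normal law. The values of \<open>f\<close> lie in a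
  Banach space so that real and complex exponentials are both covered.\<close>

lemma gaussian_variable_transfer:
  fixes f :: "real \<Rightarrow> 'b::{banach, second_countable_topology}"
  assumes "prob_space M" "gaussian_variable M Y" "integral\<^sup>L M Y = 0"
    and [measurable]: "f \<in> borel_measurable borel"
    and "s = sqrt (LINT w|M. (Y w)\<^sup>2)"
  shows "integrable M (\<lambda>w. f (Y w)) \<longleftrightarrow> integrable \<N> (\<lambda>z. f (s * z))"
    "(LINT w|M. f (Y w)) = (LINT z|\<N>. f (s * z))"
proof -
  have [measurable]: "Y \<in> borel_measurable M"
    using assms(2) by (auto simp: gaussian_variable_def)
  note D = gaussian_variable_distr(3)[OF assms(1-3), folded assms(5)]
  show "integrable M (\<lambda>w. f (Y w)) \<longleftrightarrow> integrable \<N> (\<lambda>z. f (s * z))"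
    using integrable_distr_eq[of Y M borel f] integrable_distr_eq[of "\<lambda>z. s * z" \<N> borel f] D
    by simp
  show "(LINT w|M. f (Y w)) = (LINT z|\<N>. f (s * z))"
    using integral_distr[of Y M borel f] integral_distr[of "\<lambda>z. s * z" \<N> borel f] D by simp
qed

lemma gaussian_variable_iexp:
  assumes "prob_space M" "gaussian_variable M Y" "integral\<^sup>L M Y = 0"
  shows "(CLINT w|M. iexp (Y w)) = complex_of_real (exp (- (LINT w|M. (Y w)\<^sup>2) / 2))"
proof -
  let ?s = "sqrt (LINT w|M. (Y w)\<^sup>2)"
  have "(CLINT w|M. iexp (Y w)) = char \<N> ?s"
    unfolding char_def by (subst gaussian_variable_transfer(2)[OF assms _ refl]) auto
  then show ?thesis by (simp add: char_std_normal_distribution)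
qed

lemma gaussian_variable_exp:
  assumes "prob_space M" "gaussian_variable M Y" "integral\<^sup>L M Y = 0"
  shows "integrable M (\<lambda>w. exp (l * Y w))"
    "(LINT w|M. exp (l * Y w)) = exp (l\<^sup>2 * (LINT w|M. (Y w)\<^sup>2) / 2)"
  using gaussian_variable_transfer[OF assms _ refl, of "\<lambda>y. exp (l * y)"]
    has_integral_std_normal_exp[of "l * sqrt (LINT w|M. (Y w)\<^sup>2)"]
  by (simp_all add: mult.assoc power_mult_distrib)

text \<open>Chernoff's method with \<open>x \<le> exp x\<close> applied to
  \<open>L / s * (Y w - s * L)\<close>. The parameter \<open>L / s\<close> minimises the resulting
  exponent when the variance is \<open>s\<^sup>2\<close>. The bound controls the overshoots in the
  mean maximum.\<close>

lemma gaussian_variable_excess: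
  assumes "prob_space M" "gaussian_variable M Y" "integral\<^sup>L M Y = 0"
    and "(LINT w|M. (Y w)\<^sup>2) \<le> s\<^sup>2" "s > 0" "L > 0"
  shows "integrable M (\<lambda>w. max 0 (Y w - s * L))"
    "(LINT w|M. max 0 (Y w - s * L)) \<le> s * exp (- L\<^sup>2 / 2) / L"
proof -
  interpret prob_space M by fact
  note i = gaussian_variable_distr(1)[OF assms(1-3)]
  show 1: "integrable M (\<lambda>w. max 0 (Y w - s * L))"
    using i by (intro integrable_max) auto
  define v where "v = (LINT w|M. (Y w)\<^sup>2)"
  note e = gaussian_variable_exp[OF assms(1-3), of "L / s", folded v_def]
  have "(LINT w|M. max 0 (Y w - s * L)) \<le> (LINT w|M. s * exp (- L\<^sup>2) / L * exp (L / s * Y w))"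
  proof (rule integral_mono[OF 1])
    show "integrable M (\<lambda>w. s * exp (- L\<^sup>2) / L * exp (L / s * Y w))"
      using e(1) by simp
    fix w
    have "L / s * (Y w - s * L) \<le> exp (L / s * (Y w - s * L))"
      using exp_ge_add_one_self[of "L / s * (Y w - s * L)"] by linarith
    also have "\<dots> = exp (- L\<^sup>2) * exp (L / s * Y w)"
      using assms by (simp add: exp_add[symmetric] field_simps power2_eq_square)
    finally have "Y w - s * L \<le> s * exp (- L\<^sup>2) / L * exp (L / s * Y w)"
      using assms by (simp add: field_simps)
    then show "max 0 (Y w - s * L) \<le> s * exp (- L\<^sup>2) / L * exp (L / s * Y w)"
      using assms by simp
  qed
  also have "\<dots> = s * exp (- L\<^sup>2) / L * exp ((L / s)\<^sup>2 * v / 2)"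
    using e by simp
  also have "\<dots> \<le> s * exp (- L\<^sup>2) / L * exp (L\<^sup>2 / 2)"
  proof (intro mult_left_mono)
    have "(L / s)\<^sup>2 * v \<le> (L / s)\<^sup>2 * s\<^sup>2"
      using assms(4) by (intro mult_left_mono) (auto simp: v_def)
    also have "\<dots> = L\<^sup>2" using assms by (simp add: power_divide)
    finally show "exp ((L / s)\<^sup>2 * v / 2) \<le> exp (L\<^sup>2 / 2)" by simp
  qed (use assms in auto)
  also have "\<dots> = s * exp (- L\<^sup>2 / 2) / L"
    by (simp add: exp_add[symmetric])
  finally show "(LINT w|M. max 0 (Y w - s * L)) \<le> s * exp (- L\<^sup>2 / 2) / L" .
qed

text \<open>Markov's inequality for \<open>exp (L / s * Y w)\<close>, with the same optimal
  parameter \<open>L / s\<close>.\<close>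

lemma gaussian_variable_tail:
  assumes "prob_space M" "gaussian_variable M Y" "integral\<^sup>L M Y = 0"
    and "(LINT w|M. (Y w)\<^sup>2) \<le> s\<^sup>2" "s > 0" "L > 0"
  shows "measure M {w\<in>space M. Y w \<ge> s * L} \<le> exp (- L\<^sup>2 / 2)"
proof -
  interpret prob_space M by fact
  have [measurable]: "Y \<in> borel_measurable M"
    using assms(2) by (auto simp: gaussian_variable_def)
  define v where "v = (LINT w|M. (Y w)\<^sup>2)"
  note e = gaussian_variable_exp[OF assms(1-3), of "L / s", folded v_def]
  have "measure M {w\<in>space M. Y w \<ge> s * L} = measure M {w\<in>space M. exp (L / s * Y w) \<ge> exp (L\<^sup>2)}"
    using assms by (intro arg_cong[of _ _ "measure M"] Collect_cong)
      (auto simp: field_simps power2_eq_square)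
  also have "\<dots> \<le> (LINT w|M. exp (L / s * Y w)) / exp (L\<^sup>2)"
    by (intro integral_Markov_inequality_measure[where A="{}"] e) auto
  also have "\<dots> = exp (- L\<^sup>2) * exp ((L / s)\<^sup>2 * v / 2)"
    using e by (simp add: exp_minus field_simps)
  also have "\<dots> \<le> exp (- L\<^sup>2) * exp (L\<^sup>2 / 2)"
  proof (intro mult_left_mono)
    have "(L / s)\<^sup>2 * v \<le> (L / s)\<^sup>2 * s\<^sup>2"
      using assms(4) by (intro mult_left_mono) (auto simp: v_def)
    also have "\<dots> = L\<^sup>2" using assms by (simp add: power_divide)
    finally show "exp ((L / s)\<^sup>2 * v / 2) \<le> exp (L\<^sup>2 / 2)" by simp
  qed auto
  also have "\<dots> = exp (- L\<^sup>2 / 2)"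
    by (simp add: exp_add[symmetric])
  finally show ?thesis .
qed

text \<open>By symmetry the mean of the positive part is \<open>s / 2\<close> times the mean of
  \<bar>z\<bar>, which is \<open>sqrt (2 / pi)\<close>; the constant \<open>1 / 3\<close> is a
  convenient rational bound for \<open>sqrt (2 / pi) / 2\<close>.\<close>

lemma gaussian_variable_pos_part:
  assumes "prob_space M" "gaussian_variable M Y" "integral\<^sup>L M Y = 0"
    and "(LINT w|M. (Y w)\<^sup>2) = s\<^sup>2" "s \<ge> 0"
  shows "s / 3 \<le> (LINT w|M. max 0 (Y w))"
proof -
  have s: "s = sqrt (LINT w|M. (Y w)\<^sup>2)" using assms by simp
  have i1: "integrable \<N> (\<lambda>z. z)" and e1: "(LINT z|\<N>. z) = 0"
    using integrable_std_normal_distribution_moment[of 1]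
      integral_std_normal_distribution_moment_odd[of 1] by simp_all
  have e2: "(LINT z|\<N>. \<bar>z\<bar>) = sqrt (2 / pi)"
    using std_normal_distribution_odd_moments_abs[of 0] by simp
  have "(LINT w|M. max 0 (Y w)) = (LINT z|\<N>. max 0 (s * z))"
    by (rule gaussian_variable_transfer(2)[OF assms(1-3) _ s]) simp
  also have "\<dots> = (LINT z|\<N>. s * (\<bar>z\<bar> + z) / 2)"
    using \<open>s \<ge> 0\<close>
    by (intro Bochner_Integration.integral_cong) (auto simp: max_def abs_if field_simps zero_le_mult_iff)
  also have "\<dots> = s * sqrt (2 / pi) / 2"
    using i1 e1 e2 by simp
  finally have eq: "(LINT w|M. max 0 (Y w)) = s * sqrt (2 / pi) / 2" .
  have "(2/3)\<^sup>2 \<le> 2 / pi"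
    using pi_less_4 pi_gt_zero by (simp add: field_simps power2_eq_square)
  then have "2 / 3 \<le> sqrt (2 / pi)" by (rule real_le_rsqrt)
  then have "s * (2 / 3) \<le> s * sqrt (2 / pi)" using \<open>s \<ge> 0\<close> by (rule mult_left_mono)
  then show ?thesis unfolding eq by simp
qed

section \<open>Laws of finite families\<close>

text \<open>Divided by their total mass, the weights become probability densities, and the
  hypothesis says that the images under \<open>Y\<close> and \<open>Y'\<close> have the same
  characteristic function; Levy's uniqueness theorem applies. If the mass is zero, both weights
  vanish almost everywhere.\<close>

lemma weighted_law_eq:
  fixes W :: "'a \<Rightarrow> real" and W' :: "'b \<Rightarrow> real"
  assumes "prob_space M" "prob_space M'"
    and [measurable]: "Y \<in> borel_measurable M" "Y' \<in> borel_measurable M'"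
    and W: "integrable M W" "\<And>w. 0 \<le> W w"
    and W': "integrable M' W'" "\<And>w. 0 \<le> W' w"
    and eq: "\<And>t. (CLINT w|M. W w * iexp (t * Y w)) = (CLINT w|M'. W' w * iexp (t * Y' w))"
    and [measurable]: "A \<in> sets borel"
  shows "(LINT w|M. W w * indicator A (Y w)) = (LINT w|M'. W' w * indicator A (Y' w))"
proof -
  define m where "m = integral\<^sup>L M W"
  \<comment> \<open>At \<open>t = 0\<close> the hypothesis compares the total masses, so one
    normalising constant serves both sides.\<close>
  have m': "m = integral\<^sup>L M' W'"
    using eq[of 0] by (simp add: m_def)
  have "m \<ge> 0" unfolding m_def by (simp add: W)
  have normalised: "real_distribution (distr (density M (\<lambda>w. W w / m)) borel Y)"
      "char (distr (density M (\<lambda>w. W w / m)) borel Y) = (\<lambda>t. (CLINT w|M. W w * iexp (t * Y w)) / m)"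
      "measure (distr (density M (\<lambda>w. W w / m)) borel Y) A = (LINT w|M. W w * indicator A (Y w)) / m"
    if "m > 0" and [measurable]: "Y \<in> borel_measurable M" and W: "integrable M W" "\<And>w. 0 \<le> W w"
      and m: "m = integral\<^sup>L M W"
    for M :: "'c measure" and W Y
  proof -
    have [measurable]: "W \<in> borel_measurable M" using W by auto
    interpret D: prob_space "density M (\<lambda>w. W w / m)"
    proof
      have "emeasure (density M (\<lambda>w. W w / m)) (space M) = (\<integral>\<^sup>+w. ennreal (W w / m) \<partial>M)"
        by (subst emeasure_density) (auto intro!: nn_integral_cong)
      also have "\<dots> = ennreal (LINT w|M. W w / m)"
        using W \<open>m > 0\<close> by (intro nn_integral_eq_integral) auto
      also have "\<dots> = 1" using \<open>m > 0\<close> by (simp add: m[symmetric])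
      finally show "emeasure (density M (\<lambda>w. W w / m)) (space (density M (\<lambda>w. W w / m))) = 1"
        by simp
    qed
    show "real_distribution (distr (density M (\<lambda>w. W w / m)) borel Y)"
      by (rule D.real_distribution_distr) simp
    show "char (distr (density M (\<lambda>w. W w / m)) borel Y) = (\<lambda>t. (CLINT w|M. W w * iexp (t * Y w)) / m)"
    proof
      fix t
      have "char (distr (density M (\<lambda>w. W w / m)) borel Y) t
          = (CLINT w|density M (\<lambda>w. W w / m). iexp (t * Y w))"
        unfolding char_def by (subst integral_distr) auto
      also have "\<dots> = (CLINT w|M. (W w / m) *\<^sub>R iexp (t * Y w))"
        using W \<open>m > 0\<close> by (subst integral_density) auto
      also have "\<dots> = (CLINT w|M. (W w * iexp (t * Y w)) / m)"
        by (simp add: scaleR_conv_of_real)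
      finally show "char (distr (density M (\<lambda>w. W w / m)) borel Y) t
          = (CLINT w|M. W w * iexp (t * Y w)) / m" by simp
    qed
    have "measure (distr (density M (\<lambda>w. W w / m)) borel Y) A
        = (LINT x|distr (density M (\<lambda>w. W w / m)) borel Y. indicator A x)"
      by simp
    also have "\<dots> = (LINT w|density M (\<lambda>w. W w / m). indicator A (Y w))"
      by (subst integral_distr) auto
    also have "\<dots> = (LINT w|M. (W w / m) *\<^sub>R indicator A (Y w))"
      using W \<open>m > 0\<close> by (subst integral_density) auto
    finally show "measure (distr (density M (\<lambda>w. W w / m)) borel Y) A
        = (LINT w|M. W w * indicator A (Y w)) / m" by simp
  qed
  show ?thesis
  proof (cases "m = 0")
    case True
    have ae: "AE w in M. W w = 0"
      using integral_nonneg_eq_0_iff_AE[OF W(1)] W(2) True by (simp add: m_def)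
    have ae': "AE w in M'. W' w = 0"
      using integral_nonneg_eq_0_iff_AE[OF W'(1)] W'(2) True by (simp add: m')
    have "(LINT w|M. W w * indicator A (Y w)) = 0"
      by (rule integral_eq_zero_AE) (use ae in auto)
    moreover have "(LINT w|M'. W' w * indicator A (Y' w)) = 0"
      by (rule integral_eq_zero_AE) (use ae' in auto)
    ultimately show ?thesis by simp
  next
    case False
    with \<open>m \<ge> 0\<close> have "m > 0" by simp
    note N = normalised[OF this assms(3) W m_def] and N' = normalised[OF this assms(4) W' m']
    have "distr (density M (\<lambda>w. W w / m)) borel Y = distr (density M' (\<lambda>w. W' w / m)) borel Y'"
      by (rule Levy_uniqueness[OF N(1) N'(1)]) (simp only: N(2) N'(2) eq)
    then show ?thesis using N(3) N'(3) \<open>m > 0\<close> by simp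
  qed
qed

lemma cos_iexp: "complex_of_real (cos x) = (iexp x + iexp (- x)) / 2"
  by (simp add: cos_exp_eq flip: cos_of_real)

text \<open>The coordinates in \<open>S\<close> are treated one at a time: the weights
  \<open>P (1 + cos (\<dots> + \<theta>))\<close> are nonnegative, so that one-dimensional uniqueness applies to coordinate
  \<open>j\<close>, and varying \<open>\<theta>\<close> recovers the exponential in the other coordinates.\<close>
lemma finite_family_law_eq_aux:
  fixes Y :: "'i \<Rightarrow> 'a \<Rightarrow> real" and Y' :: "'i \<Rightarrow> 'b \<Rightarrow> real"
  assumes "prob_space M" "prob_space M'" "finite I"
    and meas: "\<And>k. k \<in> I \<Longrightarrow> Y k \<in> borel_measurable M" "\<And>k. k \<in> I \<Longrightarrow> Y' k \<in> borel_measurable M'"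
    and eq: "\<And>c. (CLINT w|M. iexp (\<Sum>k\<in>I. c k * Y k w)) = (CLINT w|M'. iexp (\<Sum>k\<in>I. c k * Y' k w))"
    and A: "\<And>k. A k \<in> sets borel"
    and "S \<subseteq> I"
  shows "(CLINT w|M. complex_of_real (\<Prod>k\<in>S. indicator (A k) (Y k w)) * iexp (\<Sum>k\<in>I. c k * Y k w))
       = (CLINT w|M'. complex_of_real (\<Prod>k\<in>S. indicator (A k) (Y' k w)) * iexp (\<Sum>k\<in>I. c k * Y' k w))"
proof -
  interpret M: prob_space M by fact
  interpret M': prob_space M' by fact
  note A[measurable]
  have "finite S" using \<open>S \<subseteq> I\<close> \<open>finite I\<close> by (rule finite_subset)
  then show ?thesis using \<open>S \<subseteq> I\<close>
  proof (induction S arbitrary: c)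
    case empty
    then show ?case using eq by simp
  next
    case (insert j S)
    then have "j \<in> I" "S \<subseteq> I" by auto
    define P where "P w = (\<Prod>k\<in>S. indicator (A k) (Y k w) :: real)" for w
    define P' where "P' w = (\<Prod>k\<in>S. indicator (A k) (Y' k w) :: real)" for w
    define V where "V c w = (\<Sum>k\<in>I. c k * Y k w)" for c w
    define V' where "V' c w = (\<Sum>k\<in>I. c k * Y' k w)" for c w
    have [measurable]: "P \<in> borel_measurable M" "P' \<in> borel_measurable M'"
      "V c \<in> borel_measurable M" "V' c \<in> borel_measurable M'"
      "Y j \<in> borel_measurable M" "Y' j \<in> borel_measurable M'" for c
      unfolding P_def P'_def V_def V'_def using meas \<open>S \<subseteq> I\<close> \<open>j \<in> I\<close>
      by (auto intro!: borel_measurable_prod borel_measurable_sum borel_measurable_times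
        simp: subset_iff borel_measurable_indicator')
    have P01: "0 \<le> P w" "P w \<le> 1" for w
      unfolding P_def by (auto intro!: prod_nonneg prod_le_1)
    have P01': "0 \<le> P' w" "P' w \<le> 1" for w
      unfolding P'_def by (auto intro!: prod_nonneg prod_le_1)
    have IH: "(CLINT w|M. P w * iexp (V c w)) = (CLINT w|M'. P' w * iexp (V' c w))" for c
      using insert.IH[OF \<open>S \<subseteq> I\<close>] by (simp add: P_def P'_def V_def V'_def)
    have int: "integrable M (\<lambda>w. P w * iexp (V c w))" "integrable M' (\<lambda>w. P' w * iexp (V' c w))" for c
      using P01 P01'
      by (auto intro!: M.integrable_const_bound[where B=1] M'.integrable_const_bound[where B=1] simp: norm_mult)
    \<comment> \<open>\<open>V (d t)\<close> is \<open>t * Y j\<close>: the exponential in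
      coordinate \<open>j\<close> is absorbed into the linear combination.\<close>
    define d where "d = (\<lambda>t k. if k = j then t else (0::real))"
    have dV: "V (d t) w = t * Y j w" "V' (d t) w' = t * Y' j w'" for t w w'
      using \<open>j \<in> I\<close> \<open>finite I\<close> by (simp_all add: V_def V'_def d_def if_distrib[of "\<lambda>x. x * _"] sum.delta cong: if_cong)
    have Vadd: "V (\<lambda>k. a k + b k) w = V a w + V b w" "V' (\<lambda>k. a k + b k) w' = V' a w' + V' b w'"
       "V (\<lambda>k. a k - b k) w = V a w - V b w" "V' (\<lambda>k. a k - b k) w' = V' a w' - V' b w'" for a b w w'
      by (simp_all add: V_def V'_def distrib_right left_diff_distrib sum.distrib sum_subtractf)
    have key: "(LINT w|M. P w * (1 + cos (V c w + \<theta>)) * indicator (A j) (Y j w))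
        = (LINT w|M'. P' w * (1 + cos (V' c w + \<theta>)) * indicator (A j) (Y' j w))" for c \<theta>
    proof (rule weighted_law_eq[OF assms(1,2)])
      have bd: "0 \<le> 1 + cos x" for x :: real
        using cos_ge_minus_one[of x] by linarith
      have bd2: "p * (1 + cos x) \<le> 2" if "0 \<le> p" "p \<le> 1" for p x :: real
        using mult_mono[of p 1 "1 + cos x" 2] that cos_le_one[of x] bd[of x] by simp
      show "integrable M (\<lambda>w. P w * (1 + cos (V c w + \<theta>)))"
        using P01 bd by (intro M.integrable_const_bound[where B=2] AE_I2) (auto intro!: bd2)
      show "integrable M' (\<lambda>w. P' w * (1 + cos (V' c w + \<theta>)))"
        using P01' bd by (intro M'.integrable_const_bound[where B=2] AE_I2) (auto intro!: bd2)
      show "0 \<le> P w * (1 + cos (V c w + \<theta>))" for w using P01 bd by simp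
      show "0 \<le> P' w * (1 + cos (V' c w + \<theta>))" for w using P01' bd by simp
      fix t
      \<comment> \<open>Writing the cosine as two exponentials leaves three integrals, with
        coefficient vectors \<open>d t\<close>, \<open>d t + c\<close> and \<open>d t - c\<close>,
        each covered by the induction hypothesis.\<close>
      have e: "complex_of_real (p * (1 + cos (v + \<theta>))) * iexp y
        = p * iexp y + (iexp \<theta> / 2) * (p * iexp (y + v)) + (iexp (-\<theta>) / 2) * (p * iexp (y - v))"
        for p v y :: real
        unfolding of_real_mult of_real_add cos_iexp
        by (simp add: field_simps exp_add exp_diff exp_minus)
      have "(CLINT w|M. complex_of_real (P w * (1 + cos (V c w + \<theta>))) * iexp (t * Y j w))
        = (CLINT w|M. P w * iexp (V (d t) w)) + (iexp \<theta> / 2) * (CLINT w|M. P w * iexp (V (\<lambda>k. d t k + c k) w))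
          + (iexp (-\<theta>) / 2) * (CLINT w|M. P w * iexp (V (\<lambda>k. d t k - c k) w))"
        unfolding e dV[symmetric] Vadd[symmetric] using int by simp
      also have "\<dots> = (CLINT w|M'. P' w * iexp (V' (d t) w)) + (iexp \<theta> / 2) * (CLINT w|M'. P' w * iexp (V' (\<lambda>k. d t k + c k) w))
          + (iexp (-\<theta>) / 2) * (CLINT w|M'. P' w * iexp (V' (\<lambda>k. d t k - c k) w))"
        unfolding IH ..
      also have "\<dots> = (CLINT w|M'. complex_of_real (P' w * (1 + cos (V' c w + \<theta>))) * iexp (t * Y' j w))"
        unfolding e dV[symmetric] Vadd[symmetric] using int by simp
      finally show "(CLINT w|M. complex_of_real (P w * (1 + cos (V c w + \<theta>))) * iexp (t * Y j w)) = \<dots>" .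
    qed auto
    define Q where "Q w = P w * indicator (A j) (Y j w)" for w
    define Q' where "Q' w = P' w * indicator (A j) (Y' j w)" for w
    have Q[measurable]: "Q \<in> borel_measurable M" "Q' \<in> borel_measurable M'"
      unfolding Q_def Q'_def by measurable
    have Q01: "\<bar>Q w\<bar> \<le> 1" "\<bar>Q' w'\<bar> \<le> 1" for w w'
      using P01[of w] P01'[of w'] by (auto simp: Q_def Q'_def indicator_def)
    have m1: "\<bar>q\<bar> * \<bar>x\<bar> \<le> 1" if "\<bar>q\<bar> \<le> 1" "\<bar>x\<bar> \<le> 1" for q x :: real
      using mult_mono[OF that] by simp
    have iQ: "integrable M (\<lambda>w. Q w * f w)" if "f \<in> borel_measurable M" "\<And>w. \<bar>f w\<bar> \<le> 1" for f
      by (rule M.integrable_const_bound[where B=1]) (use that Q01 in \<open>auto simp: abs_mult intro!: m1\<close>)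
    have iQ': "integrable M' (\<lambda>w. Q' w * f w)" if "f \<in> borel_measurable M'" "\<And>w. \<bar>f w\<bar> \<le> 1" for f
      by (rule M'.integrable_const_bound[where B=1]) (use that Q01 in \<open>auto simp: abs_mult intro!: m1\<close>)
    have V0: "V (\<lambda>_. 0) w = 0" "V' (\<lambda>_. 0) w' = 0" for w w' by (simp_all add: V_def V'_def)
    have iQ1: "integrable M Q" "integrable M' Q'"
      using iQ[of "\<lambda>_. 1"] iQ'[of "\<lambda>_. 1"] by simp_all
    \<comment> \<open>For \<open>c = 0\<close> and \<theta> \<open>= 0\<close> the weight is
      \<open>2 * P\<close>, which yields equal total masses; subtracting them from
      \<open>key\<close> isolates the cosine.\<close>
    have Qeq: "integral\<^sup>L M Q = integral\<^sup>L M' Q'"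
    proof -
      have "(LINT w|M. 2 * Q w) = (LINT w|M'. 2 * Q' w)"
        using key[of "\<lambda>_. 0" 0] by (simp add: V0 Q_def Q'_def mult_ac)
      then show ?thesis by simp
    qed
    have Qcos: "(LINT w|M. Q w * cos (V c w + \<theta>)) = (LINT w|M'. Q' w * cos (V' c w + \<theta>))" for \<theta>
    proof -
      have "(LINT w|M. Q w + Q w * cos (V c w + \<theta>)) = (LINT w|M'. Q' w + Q' w * cos (V' c w + \<theta>))"
        using key[of c \<theta>] by (simp add: Q_def Q'_def algebra_simps)
      then show ?thesis
        by (subst (asm) (1 2) Bochner_Integration.integral_add) (auto simp: iQ1 Qeq intro!: iQ iQ')
    qed
    \<comment> \<open>The phases \<open>0\<close> and \<open>- pi / 2\<close> produce the real and
      the imaginary part of the exponential.\<close>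
    have split: "complex_of_real q * iexp v
        = complex_of_real (q * cos (v + 0)) + \<i> * complex_of_real (q * cos (v + - pi / 2))" for q v :: real
      using cos_minus[of "pi / 2 - v"]
      by (simp add: exp_Euler cos_diff cos_add algebra_simps flip: cos_of_real sin_of_real)
    have "(CLINT w|M. Q w * iexp (V c w)) = (CLINT w|M'. Q' w * iexp (V' c w))"
      unfolding split
      by (subst (1 2) Bochner_Integration.integral_add)
         (auto intro!: iQ iQ' integrable_mult_right integrable_of_real simp del: of_real_mult minus_divide_left
           simp: Qcos[of 0, simplified] Qcos[of "- (pi / 2)", simplified])
    then show ?case
      using insert.hyps by (simp add: Q_def Q'_def P_def P'_def V_def V'_def mult_ac)
  qed
qed

text \<open>The case \<open>S = I\<close>, \<open>c = 0\<close> of the preceding lemma: the product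
  of all indicators is the indicator of the box.\<close>

lemma finite_family_law_eq:
  fixes Y :: "'i \<Rightarrow> 'a \<Rightarrow> real" and Y' :: "'i \<Rightarrow> 'b \<Rightarrow> real"
  assumes "prob_space M" "prob_space M'" "finite I"
    and meas: "\<And>k. k \<in> I \<Longrightarrow> Y k \<in> borel_measurable M" "\<And>k. k \<in> I \<Longrightarrow> Y' k \<in> borel_measurable M'"
    and eq: "\<And>c. (CLINT w|M. iexp (\<Sum>k\<in>I. c k * Y k w)) = (CLINT w|M'. iexp (\<Sum>k\<in>I. c k * Y' k w))"
    and A: "\<And>k. A k \<in> sets borel"
  shows "measure M {w\<in>space M. \<forall>k\<in>I. Y k w \<in> A k} = measure M' {w\<in>space M'. \<forall>k\<in>I. Y' k w \<in> A k}"
proof -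
  have *: "complex_of_real (measure K {w\<in>space K. \<forall>k\<in>I. Z k w \<in> A k})
      = (CLINT w|K. complex_of_real (\<Prod>k\<in>I. indicator (A k) (Z k w)))"
    if "\<And>k. k \<in> I \<Longrightarrow> Z k \<in> borel_measurable K" for K :: "'c measure" and Z
  proof -
    note that[measurable] A[measurable]
    have "(LINT w|K. (\<Prod>k\<in>I. indicator (A k) (Z k w)))
        = (LINT w|K. indicator {w\<in>space K. \<forall>k\<in>I. Z k w \<in> A k} w :: real)"
      using \<open>finite I\<close>
      by (intro Bochner_Integration.integral_cong) (auto simp: indicator_def prod_zero_iff intro!: prod.neutral)
    also have "\<dots> = measure K {w\<in>space K. \<forall>k\<in>I. Z k w \<in> A k}"
      by (auto simp: Int_absorb2 subset_iff)
    finally have "complex_of_real (measure K {w\<in>space K. \<forall>k\<in>I. Z k w \<in> A k})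
        = complex_of_real (LINT w|K. (\<Prod>k\<in>I. indicator (A k) (Z k w)))" by simp
    then show ?thesis unfolding integral_complex_of_real .
  qed
  have "complex_of_real (measure M {w\<in>space M. \<forall>k\<in>I. Y k w \<in> A k})
      = complex_of_real (measure M' {w\<in>space M'. \<forall>k\<in>I. Y' k w \<in> A k})"
    using finite_family_law_eq_aux[of M M' I Y Y' A I "\<lambda>_. 0", OF assms order_refl]
    by (simp only: *[of Y M, OF meas(1)] *[of Y' M', OF meas(2)]) simp
  then show ?thesis by simp
qed

text \<open>The maximum is at most \<open>x\<close> exactly on the box with all sides
  \<open>{..x}\<close>, so the distribution functions of the two maxima agree.\<close>

lemma Max_law_eq:
  fixes Y :: "'i \<Rightarrow> 'a \<Rightarrow> real" and Y' :: "'i \<Rightarrow> 'b \<Rightarrow> real" and f :: "real \<Rightarrow> real"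
  assumes "prob_space M" "prob_space M'" "finite I" "I \<noteq> {}"
    and meas: "\<And>k. k \<in> I \<Longrightarrow> Y k \<in> borel_measurable M" "\<And>k. k \<in> I \<Longrightarrow> Y' k \<in> borel_measurable M'"
    and eq: "\<And>c. (CLINT w|M. iexp (\<Sum>k\<in>I. c k * Y k w)) = (CLINT w|M'. iexp (\<Sum>k\<in>I. c k * Y' k w))"
    and [measurable]: "f \<in> borel_measurable borel"
  shows "(LINT w|M. f (MAX k\<in>I. Y k w)) = (LINT w|M'. f (MAX k\<in>I. Y' k w))"
proof -
  interpret M: prob_space M by fact
  interpret M': prob_space M' by fact
  note meas[measurable]
  have [measurable]: "(\<lambda>w. MAX k\<in>I. Y k w) \<in> borel_measurable M" "(\<lambda>w. MAX k\<in>I. Y' k w) \<in> borel_measurable M'"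
    using assms(3,4) meas by (auto intro!: borel_measurable_Max)
  have "distr M borel (\<lambda>w. MAX k\<in>I. Y k w) = distr M' borel (\<lambda>w. MAX k\<in>I. Y' k w)"
  proof (rule cdf_unique)
    show "cdf (distr M borel (\<lambda>w. MAX k\<in>I. Y k w)) = cdf (distr M' borel (\<lambda>w. MAX k\<in>I. Y' k w))"
    proof
      fix x
      have "cdf (distr M borel (\<lambda>w. MAX k\<in>I. Y k w)) x = measure M {w\<in>space M. \<forall>k\<in>I. Y k w \<in> {..x}}"
        unfolding cdf_def using assms(3,4)
        by (subst measure_distr) (simp_all add: vimage_def Int_def conj_commute)
      also have "\<dots> = measure M' {w\<in>space M'. \<forall>k\<in>I. Y' k w \<in> {..x}}"
        by (rule finite_family_law_eq[OF assms(1-3) meas eq]) auto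
      also have "\<dots> = cdf (distr M' borel (\<lambda>w. MAX k\<in>I. Y' k w)) x"
        unfolding cdf_def using assms(3,4)
        by (subst measure_distr) (simp_all add: vimage_def Int_def conj_commute)
      finally show "cdf (distr M borel (\<lambda>w. MAX k\<in>I. Y k w)) x = \<dots>" .
    qed
  qed auto
  then show ?thesis
    using integral_distr[of "\<lambda>w. MAX k\<in>I. Y k w" M borel f]
      integral_distr[of "\<lambda>w. MAX k\<in>I. Y' k w" M' borel f] by simp
qed

section \<open>Finite centered Gaussian families\<close>

definition centered_gaussian_family :: "'a measure \<Rightarrow> 'i set \<Rightarrow> ('i \<Rightarrow> 'a \<Rightarrow> real) \<Rightarrow> bool" where
  "centered_gaussian_family M I Y \<longleftrightarrow> prob_space M \<and> finite I \<and>
     (\<forall>c. gaussian_variable M (\<lambda>w. \<Sum>k\<in>I. c k * Y k w)) \<and> (\<forall>k\<in>I. integral\<^sup>L M (Y k) = 0)"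

context
  fixes M :: "'a measure" and I :: "'i set" and Y :: "'i \<Rightarrow> 'a \<Rightarrow> real"
  assumes fam: "centered_gaussian_family M I Y"
begin

lemma family_prob_space: "prob_space M" and family_finite: "finite I"
  using fam by (simp_all add: centered_gaussian_family_def)

lemma family_gaussian: "gaussian_variable M (\<lambda>w. \<Sum>k\<in>I. c k * Y k w)"
  using fam by (simp add: centered_gaussian_family_def)

lemma family_mean: "k \<in> I \<Longrightarrow> integral\<^sup>L M (Y k) = 0"
  using fam by (simp add: centered_gaussian_family_def)

lemma family_member_gaussian:
  assumes "k \<in> I" shows "gaussian_variable M (Y k)"
proof -
  have "(\<lambda>w. \<Sum>i\<in>I. (if i = k then 1 else 0) * Y i w) = Y k"
    using assms family_finite by (auto simp: if_distrib[of "\<lambda>x. x * _"] cong: if_cong)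
  then show ?thesis using family_gaussian[of "\<lambda>i. if i = k then 1 else 0"] by simp
qed

lemma family_measurable: "k \<in> I \<Longrightarrow> Y k \<in> borel_measurable M"
  using family_member_gaussian by (simp add: gaussian_variable_def)

lemma family_integrable: "k \<in> I \<Longrightarrow> integrable M (Y k)"
  using gaussian_variable_distr(1)[OF family_prob_space family_member_gaussian family_mean] .

lemma family_integrable_mult:
  assumes "j \<in> I" "k \<in> I" shows "integrable M (\<lambda>w. Y j w * Y k w)"
proof (rule Bochner_Integration.integrable_bound)
  note sq = gaussian_variable_distr(2)[OF family_prob_space family_member_gaussian family_mean]
  show "integrable M (\<lambda>w. (Y j w)\<^sup>2 + (Y k w)\<^sup>2)"
    using sq assms by auto
  show "(\<lambda>w. Y j w * Y k w) \<in> borel_measurable M"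
    using family_measurable assms by auto
  have "\<bar>x * y\<bar> \<le> x\<^sup>2 + y\<^sup>2" for x y :: real
  proof -
    have "2 * (\<bar>x\<bar> * \<bar>y\<bar>) \<le> \<bar>x\<bar>\<^sup>2 + \<bar>y\<bar>\<^sup>2"
      using sum_squares_bound[of "\<bar>x\<bar>" "\<bar>y\<bar>"] by simp
    moreover have "0 \<le> \<bar>x\<bar> * \<bar>y\<bar>" by simp
    ultimately show ?thesis unfolding abs_mult power2_abs by linarith
  qed
  then show "AE w in M. norm (Y j w * Y k w) \<le> norm ((Y j w)\<^sup>2 + (Y k w)\<^sup>2)"
    by simp
qed

lemma family_combination_mean: "(LINT w|M. (\<Sum>k\<in>I. c k * Y k w)) = 0"
  by (subst Bochner_Integration.integral_sum) (auto simp: family_integrable family_mean)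

lemma family_combination_mult:
  "(LINT w|M. (\<Sum>k\<in>I. c k * Y k w) * (\<Sum>k\<in>I. d k * Y k w))
    = (\<Sum>j\<in>I. \<Sum>k\<in>I. c j * d k * (LINT w|M. Y j w * Y k w))"
proof -
  have "(LINT w|M. (\<Sum>k\<in>I. c k * Y k w) * (\<Sum>k\<in>I. d k * Y k w))
      = (LINT w|M. (\<Sum>j\<in>I. \<Sum>k\<in>I. c j * d k * (Y j w * Y k w)))"
    by (simp add: sum_product mult_ac)
  also have "\<dots> = (\<Sum>j\<in>I. \<Sum>k\<in>I. c j * d k * (LINT w|M. Y j w * Y k w))"
    using family_integrable_mult by (simp add: Bochner_Integration.integral_sum)
  finally show ?thesis .
qed

text \<open>Only the covariances enter the characteristic function, so families with equal
  covariances have equal laws.\<close>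

lemma family_iexp:
  "(CLINT w|M. iexp (\<Sum>k\<in>I. c k * Y k w))
    = complex_of_real (exp (- (\<Sum>j\<in>I. \<Sum>k\<in>I. c j * c k * (LINT w|M. Y j w * Y k w)) / 2))"
  using gaussian_variable_iexp[OF family_prob_space family_gaussian family_combination_mean, of c]
    family_combination_mult[of c c] by (simp add: power2_eq_square)

text \<open>Supplies both the rescaled grid samples and the time-reversed increments as Gaussian
  families.\<close>

lemma family_linear_image:
  assumes "finite J"
  shows "centered_gaussian_family M J (\<lambda>j w. \<Sum>k\<in>I. a j k * Y k w)"
proof -
  have "(\<Sum>j\<in>J. c j * (\<Sum>k\<in>I. a j k * Y k w)) = (\<Sum>k\<in>I. (\<Sum>j\<in>J. c j * a j k) * Y k w)" for c w
    by (simp add: sum_distrib_left sum_distrib_right mult.assoc) (rule sum.swap)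
  then show ?thesis
    using assms family_prob_space family_gaussian family_combination_mean
    by (simp add: centered_gaussian_family_def)
qed

end

lemma family_Max_law_eq:
  assumes Y: "centered_gaussian_family M I Y" and Y': "centered_gaussian_family M' I Y'" and "I \<noteq> {}"
    and cov: "\<And>j k. j \<in> I \<Longrightarrow> k \<in> I \<Longrightarrow> (LINT w|M. Y j w * Y k w) = (LINT w|M'. Y' j w * Y' k w)"
    and f: "f \<in> borel_measurable borel"
  shows "(LINT w|M. f (MAX k\<in>I. Y k w)) = (LINT w|M'. f (MAX k\<in>I. Y' k w) :: real)"
  by (rule Max_law_eq[OF family_prob_space[OF Y] family_prob_space[OF Y'] family_finite[OF Y] \<open>I \<noteq> {}\<close>
        family_measurable[OF Y] family_measurable[OF Y'] _ f])
     (simp_all only: family_iexp[OF Y] family_iexp[OF Y'] cov cong: sum.cong)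

section \<open>Shifting a Gaussian family\<close>

lemma std_normal_shift:
  fixes S :: "real set"
  assumes [measurable]: "S \<in> sets borel" and "0 \<le> d"
  shows "emeasure \<N> (S \<inter> {- L..}) \<le> ennreal (exp (L * d + d\<^sup>2 / 2)) * emeasure \<N> {z. z + d \<in> S}"
proof -
  have "emeasure \<N> (S \<inter> {- L..}) = (\<integral>\<^sup>+z. ennreal (std_normal_density z) * indicator (S \<inter> {- L..}) z \<partial>lborel)"
    by (subst emeasure_density) auto
  also have "\<dots> \<le> (\<integral>\<^sup>+z. ennreal (exp (L * d + d\<^sup>2 / 2)) * (ennreal (std_normal_density (z - d)) * indicator S z) \<partial>lborel)"
  proof (intro nn_integral_mono)
    fix z
    \<comment> \<open>The ratio of the densities at \<open>z\<close> and \<open>z - d\<close> is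
      \<open>exp (- z * d + d\<^sup>2 / 2)\<close>, which is largest at the left end
      \<open>z = - L\<close>.\<close>
    have "std_normal_density z \<le> exp (L * d + d\<^sup>2 / 2) * std_normal_density (z - d)" if "- L \<le> z"
    proof -
      have "- L * d \<le> z * d" using that \<open>0 \<le> d\<close> by (intro mult_right_mono)
      then have "- z\<^sup>2 / 2 \<le> L * d + d\<^sup>2 / 2 - (z - d)\<^sup>2 / 2"
        by (simp add: power2_eq_square field_simps)
      then have "exp (- z\<^sup>2 / 2) \<le> exp (L * d + d\<^sup>2 / 2) * exp (- (z - d)\<^sup>2 / 2)"
        by (simp flip: exp_add)
      then show ?thesis by (simp add: normal_density_def field_simps)
    qed
    then show "ennreal (std_normal_density z) * indicator (S \<inter> {- L..}) z
        \<le> ennreal (exp (L * d + d\<^sup>2 / 2)) * (ennreal (std_normal_density (z - d)) * indicator S z)"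
      by (auto simp: indicator_def simp flip: ennreal_mult)
  qed
  also have "\<dots> = ennreal (exp (L * d + d\<^sup>2 / 2)) * (\<integral>\<^sup>+z. ennreal (std_normal_density (z - d)) * indicator S z \<partial>lborel)"
    by (subst nn_integral_cmult) auto
  also have "(\<integral>\<^sup>+z. ennreal (std_normal_density (z - d)) * indicator S z \<partial>lborel)
      = (\<integral>\<^sup>+z. ennreal (std_normal_density z) * indicator {z. z + d \<in> S} z \<partial>lborel)"
    by (subst nn_integral_real_affine[where c=1 and t=d]) (auto simp: add.commute indicator_def intro!: nn_integral_cong)
  also have "\<dots> = emeasure \<N> {z. z + d \<in> S}"
    by (subst emeasure_density) auto
  finally show ?thesis .
qed

text \<open>A Cameron--Martin estimate: \<open>Y = Y' + g Z\<close> with \<open>Z = Y i\<close> standard normal and independent of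
  \<open>Y'\<close>, so that moving \<open>Z\<close> by \<open>d\<close> moves \<open>Y\<close> by \<open>d g\<close>.  The density of this shift is bounded
  by \<open>exp (L d + d\<^sup>2 / 2)\<close> on \<open>Z \<ge> - L\<close>.\<close>
lemma family_shift:
  assumes Y: "centered_gaussian_family M I Y" and i: "i \<in> I" "(LINT w|M. Y i w * Y i w) = 1"
    and g: "\<And>k. k \<in> I \<Longrightarrow> g k = (LINT w|M. Y k w * Y i w)" and "0 \<le> d"
  shows "measure M {w\<in>space M. (\<forall>k\<in>I. Y k w \<le> u k) \<and> - L \<le> Y i w}
    \<le> exp (L * d + d\<^sup>2 / 2) * measure M {w\<in>space M. \<forall>k\<in>I. Y k w \<le> u k - d * g k}"
proof -
  interpret prob_space M by (rule family_prob_space[OF Y])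
  interpret N: prob_space \<N> by (rule prob_space_std_normal)
  interpret P: pair_prob_space M \<N> ..
  note [measurable] = family_measurable[OF Y]
  \<comment> \<open>On the product space the component of \<open>Y k\<close> along
    \<open>Y i\<close> is replaced by an independent standard normal coordinate. The family keeps
    its law, and its coordinate \<open>i\<close> becomes a free variable that can be
    translated.\<close>
  define Z where "Z k x = Y k (fst x) - g k * Y i (fst x) + g k * snd x" for k and x :: "'a \<times> real"
  have Z[measurable]: "k \<in> I \<Longrightarrow> Z k \<in> borel_measurable (M \<Otimes>\<^sub>M \<N>)" for k
    unfolding Z_def using i by measurable
  have gi: "g i = 1" using g i by simp
  have char: "(CLINT w|M. iexp (\<Sum>k\<in>I. c k * Y k w)) = (CLINT x|M \<Otimes>\<^sub>M \<N>. iexp (\<Sum>k\<in>I. c k * Z k x))" for c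
  proof -
    \<comment> \<open>\<open>G\<close> is the covariance of the combination with \<open>Y i\<close>.
      Removing \<open>G * Y i\<close> lowers the variance by \<open>G\<^sup>2\<close>, and the
      independent normal term restores exactly this amount.\<close>
    define G where "G = (\<Sum>k\<in>I. c k * g k)"
    define e where "e k = (if k = i then G else 0)" for k
    define V where "V = (\<lambda>w. \<Sum>k\<in>I. c k * Y k w)"
    define U where "U = (\<lambda>w. \<Sum>k\<in>I. (c k - e k) * Y k w)"
    have eY: "(\<Sum>k\<in>I. e k * Y k w) = G * Y i w" for w
      using i family_finite[OF Y] by (simp add: e_def if_distrib[of "\<lambda>x. x * _"] cong: if_cong)
    have U: "U w = V w - G * Y i w" for w
      unfolding U_def V_def left_diff_distrib sum_subtractf eY ..
    have [measurable]: "V \<in> borel_measurable M" "U \<in> borel_measurable M"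
      unfolding V_def U_def by measurable
    have ZV: "(\<Sum>k\<in>I. c k * Z k x) = U (fst x) + G * snd x" for x
      unfolding U V_def G_def Z_def
      by (simp add: algebra_simps sum.distrib sum_subtractf sum_distrib_left sum_distrib_right)
    have VG: "(LINT w|M. V w * (G * Y i w)) = G\<^sup>2"
    proof -
      have "(LINT w|M. V w * (G * Y i w)) = G * (\<Sum>k\<in>I. c k * (LINT w|M. Y k w * Y i w))"
        using family_integrable_mult[OF Y] i
        by (simp add: V_def sum_distrib_right mult.assoc mult.left_commute[of _ G] Bochner_Integration.integral_sum)
      then show ?thesis using g by (simp add: G_def power2_eq_square)
    qed
    have VV: "V w * V w = (\<Sum>j\<in>I. \<Sum>k\<in>I. c j * c k * (Y j w * Y k w))"
      "V w * (G * Y i w) = (\<Sum>k\<in>I. (c k * G) * (Y k w * Y i w))"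
      "(G * Y i w) * (G * Y i w) = (G * G) * (Y i w * Y i w)" for w
      by (simp_all add: V_def sum_distrib_left sum_distrib_right mult_ac)
    have iV: "integrable M (\<lambda>w. V w * V w)" "integrable M (\<lambda>w. V w * (G * Y i w))"
      "integrable M (\<lambda>w. (G * Y i w) * (G * Y i w))"
      unfolding VV using family_integrable_mult[OF Y] i
      by (intro Bochner_Integration.integrable_sum integrable_mult_right; blast)+
    have "(LINT w|M. U w * U w) = (LINT w|M. V w * V w - 2 * (V w * (G * Y i w)) + (G * Y i w) * (G * Y i w))"
      by (simp add: U algebra_simps)
    also have "\<dots> = (LINT w|M. V w * V w) - 2 * G\<^sup>2 + (LINT w|M. (G * Y i w) * (G * Y i w))"
      using iV VG by simp
    also have "(LINT w|M. (G * Y i w) * (G * Y i w)) = (LINT w|M. G\<^sup>2 * (Y i w * Y i w))"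
      by (simp add: power2_eq_square mult_ac)
    also have "\<dots> = G\<^sup>2" using i by simp
    finally have var: "(LINT w|M. U w * U w) = (LINT w|M. V w * V w) - G\<^sup>2" by simp
    have ie: "(CLINT w|M. iexp (\<Sum>k\<in>I. a k * Y k w)) = complex_of_real (exp (-
        (LINT w|M. (\<Sum>k\<in>I. a k * Y k w) * (\<Sum>k\<in>I. a k * Y k w)) / 2))" for a
      unfolding family_iexp[OF Y] family_combination_mult[OF Y] ..
    have "(CLINT x|M \<Otimes>\<^sub>M \<N>. iexp (U (fst x)) * iexp (G * snd x))
      = (CLINT w|M. (CLINT z|\<N>. iexp (U w) * iexp (G * z)))"
      by (subst P.integral_fst'[symmetric]) (auto intro!: P.P.integrable_const_bound[where B=1] simp: norm_mult)
    also have "\<dots> = (CLINT w|M. iexp (U w)) * char \<N> G"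
      by (simp add: char_def)
    also have "\<dots> = complex_of_real (exp (- (LINT w|M. U w * U w) / 2) * exp (- G\<^sup>2 / 2))"
      unfolding U_def ie by (simp add: char_std_normal_distribution)
    also have "\<dots> = complex_of_real (exp (- (LINT w|M. V w * V w) / 2))"
      unfolding var by (simp add: field_simps flip: exp_add)
    also have "\<dots> = (CLINT w|M. iexp (\<Sum>k\<in>I. c k * Y k w))"
      unfolding ie V_def ..
    finally show ?thesis unfolding ZV by (simp add: exp_add distrib_left)
  qed
  define S where "S w = {z. \<forall>k\<in>I. Z k (w, z) \<le> u k}" for w
  have [measurable]: "finite I" by (rule family_finite[OF Y])
  have S: "S w \<in> sets borel" if "w \<in> space M" for w
  proof -
    have "S w = (\<Inter>k\<in>I. {z. Z k (w, z) \<le> u k})" by (auto simp: S_def)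
    also have "\<dots> \<in> sets borel"
      using i(1) family_finite[OF Y] by (intro sets.finite_INT) (auto simp: Z_def)
    finally show ?thesis .
  qed
  \<comment> \<open>The lower bound on \<open>Y i\<close> is encoded in the side \<open>i\<close> of
    the box, so that equality of laws on boxes suffices.\<close>
  define A where "A k = (if k = i then {- L..u k} else {..u k})" for k
  define A' where "A' k = {..u k - d * g k}" for k
  define F where "F = {x \<in> space (M \<Otimes>\<^sub>M \<N>). \<forall>k\<in>I. Z k x \<in> A k}"
  define F' where "F' = {x \<in> space (M \<Otimes>\<^sub>M \<N>). \<forall>k\<in>I. Z k x \<in> A' k}"
  have Am[measurable]: "A k \<in> sets borel" "A' k \<in> sets borel" for k by (auto simp: A_def A'_def)
  have Fm[measurable]: "F \<in> sets (M \<Otimes>\<^sub>M \<N>)" "F' \<in> sets (M \<Otimes>\<^sub>M \<N>)"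
    unfolding F_def F'_def by measurable
  have A: "(\<forall>k\<in>I. y k \<in> A k) \<longleftrightarrow> (\<forall>k\<in>I. y k \<le> u k) \<and> - L \<le> y i" for y
  proof -
    have "y k \<in> A k \<longleftrightarrow> y k \<le> u k \<and> (k = i \<longrightarrow> - L \<le> y k)" for k
      by (simp add: A_def conj_commute)
    then show ?thesis using i(1) by blast
  qed
  have Zi: "Z i (w, z) = z" for w z by (simp add: Z_def gi)
  have F: "Pair w -` F = S w \<inter> {- L..}" if "w \<in> space M" for w
    unfolding F_def A using that by (simp add: S_def vimage_def Zi space_pair_measure Int_def)
  \<comment> \<open>Raising the normal coordinate by \<open>d\<close> raises \<open>Z k\<close> by
    \<open>d * g k\<close>; hence the sections of \<open>F'\<close> are translates of the sets
    \<open>S w\<close>.\<close>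
  have "Z k (w, z) \<le> u k - d * g k \<longleftrightarrow> Z k (w, z + d) \<le> u k" for k w z
    by (simp add: Z_def algebra_simps)
  then have F': "Pair w -` F' = {z. z + d \<in> S w}" if "w \<in> space M" for w
    unfolding F'_def A'_def using that by (simp add: S_def vimage_def space_pair_measure)
  note law = finite_family_law_eq[OF prob_space_axioms P.P.prob_space_axioms family_finite[OF Y]
      family_measurable[OF Y] Z char]
  have "emeasure (M \<Otimes>\<^sub>M \<N>) F = (\<integral>\<^sup>+w. emeasure \<N> (S w \<inter> {- L..}) \<partial>M)"
    unfolding N.emeasure_pair_measure_alt[OF Fm(1)] by (intro nn_integral_cong) (simp add: F)
  also have "\<dots> \<le> (\<integral>\<^sup>+w. ennreal (exp (L * d + d\<^sup>2 / 2)) * emeasure \<N> {z. z + d \<in> S w} \<partial>M)"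
    by (intro nn_integral_mono std_normal_shift S \<open>0 \<le> d\<close>)
  also have "\<dots> = (\<integral>\<^sup>+w. ennreal (exp (L * d + d\<^sup>2 / 2)) * emeasure \<N> (Pair w -` F') \<partial>M)"
    by (intro nn_integral_cong) (simp add: F')
  also have "\<dots> = ennreal (exp (L * d + d\<^sup>2 / 2)) * emeasure (M \<Otimes>\<^sub>M \<N>) F'"
    unfolding N.emeasure_pair_measure_alt[OF Fm(2)]
    by (rule nn_integral_cmult) (rule N.measurable_emeasure_Pair[OF Fm(2)])
  finally have "ennreal (measure (M \<Otimes>\<^sub>M \<N>) F) \<le> ennreal (exp (L * d + d\<^sup>2 / 2) * measure (M \<Otimes>\<^sub>M \<N>) F')"
    by (simp add: P.P.emeasure_eq_measure ennreal_mult)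
  then have *: "measure (M \<Otimes>\<^sub>M \<N>) F \<le> exp (L * d + d\<^sup>2 / 2) * measure (M \<Otimes>\<^sub>M \<N>) F'"
    by (subst (asm) ennreal_le_iff) auto
  then show ?thesis
    using law[of A] law[of A'] unfolding F_def F'_def A by (simp add: A'_def)
qed

section \<open>Fractional Brownian motion on the integers\<close>

definition fbm_cov :: "real \<Rightarrow> real \<Rightarrow> real \<Rightarrow> real" where
  "fbm_cov H t s = (\<bar>t\<bar> powr (2 * H) + \<bar>s\<bar> powr (2 * H) - \<bar>t - s\<bar> powr (2 * H)) / 2"

text \<open>Self-similarity brings a grid of any mesh to integer times, so the estimates below do
  not involve the mesh.\<close>

locale discrete_fbm =
  fixes H :: real and M :: "'a measure" and Y :: "nat \<Rightarrow> 'a \<Rightarrow> real"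
  assumes H: "0 < H" "H < 1"
    and fam: "finite I \<Longrightarrow> centered_gaussian_family M I Y"
    and cov: "(LINT w|M. Y j w * Y k w) = fbm_cov H (real j) (real k)"
begin

sublocale prob_space M
  using family_prob_space[OF fam[of "{}"]] by simp

lemma Y_gaussian: "gaussian_variable M (Y k)" and Y_mean: "integral\<^sup>L M (Y k) = 0"
  and Y_measurable[measurable]: "Y k \<in> borel_measurable M" and Y_integrable[simp]: "integrable M (Y k)"
  using family_member_gaussian[OF fam[of "{k}"]] family_mean[OF fam[of "{k}"]]
    family_measurable[OF fam[of "{k}"]] family_integrable[OF fam[of "{k}"]] by auto

lemma Y_variance: "(LINT w|M. (Y k w)\<^sup>2) = (real k powr H)\<^sup>2"
proof -
  have "(LINT w|M. (Y k w)\<^sup>2) = real k powr (H + H)"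
    using cov[of k k] by (simp add: fbm_cov_def power2_eq_square)
  also have "\<dots> = (real k powr H)\<^sup>2"
    by (simp only: powr_add power2_eq_square)
  finally show ?thesis .
qed

section \<open>Time reversal, mean maximum and excess\<close>

lemma reversed_family: "centered_gaussian_family M {1..n} (\<lambda>k w. Y (n - k) w - Y n w)"
proof -
  have "(\<Sum>i\<le>n. (of_bool (i = n - k) - of_bool (i = n)) * Y i w) = Y (n - k) w - Y n w" for k w
    by (simp add: left_diff_distrib sum_subtractf of_bool_def if_distrib[of "\<lambda>x. x * _"] cong: if_cong)
  then show ?thesis
    using family_linear_image[OF fam[of "{..n}"], of "{1..n}" "\<lambda>k i. of_bool (i = n - k) - of_bool (i = n)"]
    by simp
qed

text \<open>Stationarity and reversibility of the increments, checked on covariances: the powers of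
  \<open>n\<close>, \<open>n - j\<close> and \<open>n - k\<close> cancel.\<close>

lemma reversed_cov:
  assumes "j \<in> {1..n}" "k \<in> {1..n}"
  shows "(LINT w|M. (Y (n - j) w - Y n w) * (Y (n - k) w - Y n w)) = (LINT w|M. Y j w * Y k w)"
proof -
  have i: "integrable M (\<lambda>w. Y j w * Y k w)" for j k
    using family_integrable_mult[OF fam[of "{j, k}"]] by simp
  have "(LINT w|M. (Y (n - j) w - Y n w) * (Y (n - k) w - Y n w))
      = (LINT w|M. Y (n - j) w * Y (n - k) w - Y (n - j) w * Y n w - Y n w * Y (n - k) w + Y n w * Y n w)"
    by (simp add: algebra_simps)
  also have "\<dots> = fbm_cov H (real (n - j)) (real (n - k)) - fbm_cov H (real (n - j)) (real n)
      - fbm_cov H (real n) (real (n - k)) + fbm_cov H (real n) (real n)"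
    by (simp add: i cov)
  also have "\<dots> = fbm_cov H (real j) (real k)"
    using assms by (simp add: fbm_cov_def of_nat_diff abs_minus_commute field_simps)
  finally show ?thesis using cov by simp
qed

text \<open>For \<open>n \<ge> 1\<close> the integrand is positive exactly when \<open>Y 1\<close>,
  ..., \<open>Y n\<close> are all negative. Index \<open>0\<close> is left out because
  \<open>Y 0\<close> vanishes almost surely, which would make the excess zero.\<close>

definition excess :: "nat \<Rightarrow> real" where
  "excess n = (LINT w|M. max 0 (- (MAX k\<in>{1..n}. Y k w)))"

definition mean_max :: "nat \<Rightarrow> real" where
  "mean_max n = (LINT w|M. (MAX k\<in>{..n}. Y k w))"

lemma integrable_Max:
  assumes "finite I" "I \<noteq> {}" shows "integrable M (\<lambda>w. MAX k\<in>I. Y k w)"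
  using assms
proof (induction rule: finite_ne_induct)
  case (insert i I)
  then have "(\<lambda>w. MAX k\<in>insert i I. Y k w) = (\<lambda>w. max (Y i w) (MAX k\<in>I. Y k w))"
    by (auto intro!: ext Max_insert)
  then show ?case using insert by simp
qed simp

lemma integrable_excess: "n \<ge> 1 \<Longrightarrow> integrable M (\<lambda>w. max 0 (- (MAX k\<in>{1..n}. Y k w)))"
  by (intro integrable_max integrable_minus integrable_Max) auto

lemma excess_nonneg: "excess n \<ge> 0"
  unfolding excess_def by simp

lemma excess_antimono:
  assumes "1 \<le> m" "m \<le> n" shows "excess n \<le> excess m"
  unfolding excess_def
proof (intro integral_mono integrable_excess)
  fix w
  have "(MAX k\<in>{1..m}. Y k w) \<le> (MAX k\<in>{1..n}. Y k w)"
    using assms by (intro Max_mono) auto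
  then show "max 0 (- (MAX k\<in>{1..n}. Y k w)) \<le> max 0 (- (MAX k\<in>{1..m}. Y k w))" by simp
qed (use assms in auto)

text \<open>Time reversal turns the increment of the running maximum into the excess below zero.\<close>
lemma mean_max_Suc: "mean_max (Suc n) = mean_max n + excess (Suc n)"
proof -
  \<comment> \<open>The new maximum exceeds the old one by the positive part of
    \<open>Y (Suc n)\<close> minus the old maximum, and the old maximum minus
    \<open>Y (Suc n)\<close> is the maximum of the reversed increments.\<close>
  have pt: "(MAX k\<in>{..Suc n}. Y k w) = (MAX k\<in>{..n}. Y k w)
      + max 0 (- (MAX k\<in>{1..Suc n}. Y (Suc n - k) w - Y (Suc n) w))" for w
  proof -
    have "(\<lambda>k. Y (Suc n - k) w - Y (Suc n) w) ` {1..Suc n} = (\<lambda>k. Y k w - Y (Suc n) w) ` {..n}"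
    proof (intro equalityI subsetI)
      fix x assume "x \<in> (\<lambda>k. Y k w - Y (Suc n) w) ` {..n}"
      then obtain k where "k \<le> n" "x = Y k w - Y (Suc n) w" by auto
      then show "x \<in> (\<lambda>k. Y (Suc n - k) w - Y (Suc n) w) ` {1..Suc n}"
        by (intro image_eqI[of _ _ "Suc n - k"]) auto
    qed auto
    then have "(MAX k\<in>{1..Suc n}. Y (Suc n - k) w - Y (Suc n) w) = (MAX k\<in>{..n}. Y k w - Y (Suc n) w)"
      by simp
    also have "\<dots> = (MAX k\<in>{..n}. Y k w + (- Y (Suc n) w))" by simp
    also have "\<dots> = (MAX k\<in>{..n}. Y k w) + (- Y (Suc n) w)"
      by (rule Max_add_commute) auto
    finally have "(MAX k\<in>{1..Suc n}. Y (Suc n - k) w - Y (Suc n) w) = \<dots>" .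
    moreover have "(MAX k\<in>{..Suc n}. Y k w) = max (Y (Suc n) w) (MAX k\<in>{..n}. Y k w)"
      by (simp add: atMost_Suc)
    ultimately show ?thesis by simp
  qed
  have i: "integrable M (\<lambda>w. MAX k\<in>{..n}. Y k w)" for n by (rule integrable_Max) auto
  have "mean_max (Suc n) - mean_max n = (LINT w|M. (MAX k\<in>{..Suc n}. Y k w) - (MAX k\<in>{..n}. Y k w))"
    using i by (simp add: mean_max_def)
  also have "\<dots> = (LINT w|M. max 0 (- (MAX k\<in>{1..Suc n}. Y (Suc n - k) w - Y (Suc n) w)))"
    unfolding pt by simp
  also have "\<dots> = excess (Suc n)"
    unfolding excess_def
    by (rule family_Max_law_eq[OF reversed_family fam, where f="\<lambda>x. max 0 (- x)"])
       (auto simp only: reversed_cov, auto)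
  finally show ?thesis by simp
qed

lemma mean_max_eq: "mean_max n = (\<Sum>k\<in>{1..n}. excess k)"
proof (induction n)
  case 0
  then show ?case by (simp add: mean_max_def Y_mean)
qed (simp add: mean_max_Suc)

text \<open>The maximum dominates that of \<open>Y 0\<close> and \<open>Y n\<close>, which is
  \<open>Y n\<close> plus the positive part of \<open>Y 0 - Y n\<close>; the first summand is
  centered and the second has standard deviation \<open>n powr H\<close>.\<close>

lemma mean_max_lower: "real n powr H / 3 \<le> mean_max n"
proof (cases "n = 0")
  case True
  then show ?thesis by (simp add: mean_max_eq)
next
  case False
  note rev = reversed_family[of n]
  have n: "n \<in> {1..n}" using False by simp
  have Z: "gaussian_variable M (\<lambda>w. Y 0 w - Y n w)" "(LINT w|M. Y 0 w - Y n w) = 0"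
    using family_member_gaussian[OF rev n] family_mean[OF rev n] by simp_all
  have V: "(LINT w|M. (Y 0 w - Y n w)\<^sup>2) = (real n powr H)\<^sup>2"
    using reversed_cov[OF n n] Y_variance[of n] by (simp add: power2_eq_square)
  have "real n powr H / 3 \<le> (LINT w|M. max 0 (Y 0 w - Y n w))"
    by (rule gaussian_variable_pos_part[OF prob_space_axioms Z V]) simp
  also have "\<dots> = (LINT w|M. max 0 (Y 0 w - Y n w) + Y n w)"
    by (subst Bochner_Integration.integral_add) (auto simp: Y_mean)
  also have "\<dots> \<le> mean_max n"
    unfolding mean_max_def
  proof (intro integral_mono integrable_Max)
    fix w
    have "Y 0 w \<le> (MAX k\<in>{..n}. Y k w)" "Y n w \<le> (MAX k\<in>{..n}. Y k w)" by (auto intro!: Max_ge)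
    then show "max 0 (Y 0 w - Y n w) + Y n w \<le> (MAX k\<in>{..n}. Y k w)" by linarith
  qed auto
  finally show ?thesis .
qed

text \<open>The maximum is at most the level \<open>s * L\<close> plus all overshoots above it. The
  condition on \<open>L\<close> makes the \<open>n + 1\<close> overshoots contribute at most
  \<open>s / L\<close> in total.\<close>

lemma mean_max_upper:
  assumes L: "1 \<le> L" "real n + 1 \<le> exp (L\<^sup>2 / 2)" and "n \<ge> 1"
  shows "mean_max n \<le> 2 * L * real n powr H"
proof -
  define s where "s = real n powr H"
  have s: "s > 0" using \<open>n \<ge> 1\<close> by (simp add: s_def)
  have V: "(LINT w|M. (Y k w)\<^sup>2) \<le> s\<^sup>2" if "k \<le> n" for k
    unfolding Y_variance s_def using that H by (intro power_mono powr_mono2) auto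
  note ex = gaussian_variable_excess[OF prob_space_axioms Y_gaussian Y_mean V s, of _ L]
  have "mean_max n \<le> (LINT w|M. s * L + (\<Sum>k\<le>n. max 0 (Y k w - s * L)))"
    unfolding mean_max_def
  proof (intro integral_mono integrable_Max)
    fix w
    show "(MAX k\<in>{..n}. Y k w) \<le> s * L + (\<Sum>k\<le>n. max 0 (Y k w - s * L))"
    proof (subst Max_le_iff; clarsimp)
      fix k assume "k \<le> n"
      have "Y k w - s * L \<le> max 0 (Y k w - s * L)" by simp
      also have "\<dots> \<le> (\<Sum>k\<le>n. max 0 (Y k w - s * L))"
        by (rule member_le_sum) (use \<open>k \<le> n\<close> in auto)
      finally show "Y k w \<le> s * L + (\<Sum>k\<le>n. max 0 (Y k w - s * L))" by simp
    qed
  qed (use ex L in auto)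
  also have "\<dots> = s * L + (\<Sum>k\<le>n. (LINT w|M. max 0 (Y k w - s * L)))"
    using ex L by (subst Bochner_Integration.integral_add)
      (auto simp: Bochner_Integration.integral_sum prob_space)
  also have "\<dots> \<le> s * L + (\<Sum>k\<le>n. s * exp (- L\<^sup>2 / 2) / L)"
    using ex L by (intro add_left_mono sum_mono) auto
  also have "\<dots> = s * L + s / L * ((real n + 1) * exp (- L\<^sup>2 / 2))"
    by (simp add: add.commute)
  also have "\<dots> \<le> s * L + s * L * 1"
  proof (intro add_left_mono mult_mono)
    have "1 / L \<le> L" using L mult_mono[of 1 L 1 L] by (simp add: field_simps)
    then show "s / L \<le> s * L" using mult_left_mono[of "1 / L" L s] s by simp
    show "(real n + 1) * exp (- L\<^sup>2 / 2) \<le> 1"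
      using L by (simp add: exp_minus field_simps)
  qed (use s L in auto)
  finally show ?thesis by (simp add: s_def mult_ac)
qed

text \<open>The excess is decreasing, so \<open>n * excess n\<close> is at most the sum of the first
  \<open>n\<close> excesses, which is the mean maximum.\<close>

lemma excess_upper:
  assumes "1 \<le> L" "real n + 1 \<le> exp (L\<^sup>2 / 2)" "n \<ge> 1"
  shows "excess n \<le> 2 * L * real n powr (H - 1)"
proof -
  have "real n * excess n = (\<Sum>k\<in>{1..n}. excess n)" by simp
  also have "\<dots> \<le> mean_max n"
    unfolding mean_max_eq using \<open>n \<ge> 1\<close> by (intro sum_mono excess_antimono) auto
  also have "\<dots> \<le> 2 * L * real n powr H"
    by (rule mean_max_upper[OF assms])
  finally show ?thesis
    using \<open>n \<ge> 1\<close> by (simp add: powr_diff field_simps)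
qed

text \<open>The choice of \<open>K\<close> makes the mean maximum at \<open>n * K\<close> at least
  \<open>4 * L * n powr H\<close>, twice the upper bound at \<open>n\<close>. The difference is a
  sum of fewer than \<open>n * K\<close> excesses, none larger than \<open>excess n\<close>.\<close>

lemma excess_lower:
  assumes L: "1 \<le> L" "real n + 1 \<le> exp (L\<^sup>2 / 2)" "n \<ge> 1" and K: "12 * L \<le> real K powr H"
  shows "2 * L * real n powr (H - 1) / real K \<le> excess n"
proof -
  have "K \<noteq> 0" using K L H by (cases "K = 0") auto
  then have nK: "n \<le> n * K" by simp
  have split: "(\<Sum>k\<in>{1..m}. excess k) = (\<Sum>k\<in>{1..n}. excess k) + (\<Sum>k\<in>{n<..m}. excess k)"
    if "n \<le> m" for m
    using that by (subst sum.union_disjoint[symmetric]) (auto intro!: sum.cong)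
  have "4 * L * real n powr H \<le> real (n * K) powr H / 3"
    using mult_left_mono[OF K, of "real n powr H"] by (simp add: powr_mult mult_ac)
  also have "\<dots> \<le> mean_max (n * K)" by (rule mean_max_lower)
  also have "\<dots> = mean_max n + (\<Sum>k\<in>{n<..n*K}. excess k)"
    unfolding mean_max_eq by (rule split[OF nK])
  also have "\<dots> \<le> 2 * L * real n powr H + (\<Sum>k\<in>{n<..n*K}. excess n)"
    using L by (intro add_mono mean_max_upper sum_mono excess_antimono) auto
  also have "(\<Sum>k\<in>{n<..n*K}. excess n) \<le> real (n * K) * excess n"
    using excess_nonneg[of n] by (simp add: mult_right_mono flip: of_nat_mult)
  finally have "2 * L * real n powr H \<le> real n * real K * excess n"
    by simp
  then show ?thesis
    using \<open>n \<ge> 1\<close> \<open>K \<noteq> 0\<close> by (simp add: powr_diff field_simps)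
qed

section \<open>From the excess to probabilities\<close>

lemma excess_le_prob:
  assumes L: "1 \<le> L" and "n \<ge> 1"
  shows "excess n \<le> L * prob {w\<in>space M. \<forall>k\<in>{1..n}. Y k w \<le> 0} + exp (- L\<^sup>2 / 2)"
proof -
  define E where "E = {w\<in>space M. \<forall>k\<in>{1..n}. Y k w \<le> 0}"
  have [measurable]: "E \<in> sets M" unfolding E_def by measurable
  have iE: "integrable M (\<lambda>w. L * indicator E w)"
    by (intro integrable_mult_right integrable_real_indicator) (auto simp: emeasure_eq_measure)
  have "(\<Sum>i\<in>{1::nat}. - 1 * Y i w) = - Y 1 w" for w by simp
  then have gm: "gaussian_variable M (\<lambda>w. - Y 1 w)"
    using family_gaussian[OF fam[of "{1}"], of "\<lambda>_. - 1"] by simp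
  have mm: "(LINT w|M. - Y 1 w) = 0" "(LINT w|M. (- Y 1 w)\<^sup>2) \<le> 1\<^sup>2"
    using Y_variance[of 1] by (simp_all add: Y_mean)
  have ex: "integrable M (\<lambda>w. max 0 (- Y 1 w - L))"
    "(LINT w|M. max 0 (- Y 1 w - L)) \<le> exp (- L\<^sup>2 / 2) / L"
    using gaussian_variable_excess[OF prob_space_axioms gm mm, of L] L by simp_all
  \<comment> \<open>Truncation at \<open>L\<close>: outside \<open>E\<close> the integrand vanishes,
    and on \<open>E\<close> it is at most \<open>- Y 1 w\<close>, hence at most \<open>L\<close>
    plus the overshoot of \<open>- Y 1 w\<close> above \<open>L\<close>.\<close>
  have "excess n \<le> (LINT w|M. L * indicator E w + max 0 (- Y 1 w - L))"
    unfolding excess_def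
  proof (intro integral_mono integrable_excess \<open>n \<ge> 1\<close>)
    fix w assume w: "w \<in> space M"
    have 1: "Y 1 w \<le> (MAX k\<in>{1..n}. Y k w)" using \<open>n \<ge> 1\<close> by (intro Max_ge) auto
    show "max 0 (- (MAX k\<in>{1..n}. Y k w)) \<le> L * indicator E w + max 0 (- Y 1 w - L)"
    proof (cases "w \<in> E")
      case True
      then show ?thesis using 1 L by simp
    next
      case False
      then obtain k where "k \<in> {1..n}" "Y k w > 0" using w by (auto simp: E_def not_le)
      then have "0 < (MAX k\<in>{1..n}. Y k w)" by (subst Max_gr_iff) auto
      then show ?thesis using False by simp
    qed
  qed (rule Bochner_Integration.integrable_add[OF iE ex(1)])
  also have "\<dots> = L * prob E + (LINT w|M. max 0 (- Y 1 w - L))"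
    by (subst Bochner_Integration.integral_add[OF iE ex(1)]) simp
  also note ex(2)
  also have "exp (- L\<^sup>2 / 2) / L \<le> exp (- L\<^sup>2 / 2)" using L by (simp add: field_simps)
  finally show ?thesis by (simp add: E_def)
qed

lemma prob_nonpos_lower:
  assumes L: "1 \<le> L" "real n + 1 \<le> exp (L\<^sup>2 / 2)" "n \<ge> 1" and K: "12 * L \<le> real K powr H"
  shows "2 * real n powr (H - 1) / real K - exp (- L\<^sup>2 / 2)
    \<le> prob {w\<in>space M. \<forall>k\<in>{1..n}. Y k w \<le> 0}" (is "_ \<le> ?p")
proof -
  have "2 * L * real n powr (H - 1) / real K \<le> L * ?p + exp (- L\<^sup>2 / 2)"
    using excess_lower[OF assms] excess_le_prob[OF L(1,3)] by linarith
  also have "exp (- L\<^sup>2 / 2) \<le> L * exp (- L\<^sup>2 / 2)" using L by simp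
  finally have "L * (2 * real n powr (H - 1) / real K) \<le> L * (?p + exp (- L\<^sup>2 / 2))"
    by (simp add: algebra_simps)
  then have "2 * real n powr (H - 1) / real K \<le> ?p + exp (- L\<^sup>2 / 2)"
    using L by (subst (asm) mult_le_cancel_left_pos) auto
  then show ?thesis by linarith
qed

text \<open>The shift goes in the direction of \<open>Y 1\<close>, whose covariance with every \<open>Y k\<close> is at least
  \<open>1 / 2\<close>.\<close>
lemma prob_le_upper:
  assumes L: "1 \<le> L" "real n + 1 \<le> exp (L\<^sup>2 / 2)" "n \<ge> 1"
  shows "prob {w\<in>space M. \<forall>k\<in>{1..n}. Y k w \<le> 1 / L}
    \<le> 2 * exp 12 * L\<^sup>2 * real n powr (H - 1) + exp (- L\<^sup>2 / 2)"
proof -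
  define g where "g k = (LINT w|M. Y k w * Y 1 w)" for k
  have g: "g k \<ge> 1 / 2" if "k \<in> {1..n}" for k
  proof -
    have "(real k - 1) powr (2 * H) \<le> real k powr (2 * H)"
      using that H by (intro powr_mono2) auto
    then show ?thesis using that by (simp add: g_def cov fbm_cov_def)
  qed
  have Y1: "(LINT w|M. Y 1 w * Y 1 w) = 1" by (simp add: cov fbm_cov_def)
  \<comment> \<open>The shift is \<open>d = 4 / L\<close>. As \<open>g k \<ge> 1 / 2\<close>, each
    level drops by at least \<open>2 / L\<close>, from \<open>1 / L\<close> to at most
    \<open>- 1 / L\<close>, while the exponent is \<open>4 + 8 / L\<^sup>2 \<le> 12\<close>.\<close>
  have "prob {w\<in>space M. (\<forall>k\<in>{1..n}. Y k w \<le> 1 / L) \<and> - L \<le> Y 1 w}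
      \<le> exp (L * (4 / L) + (4 / L)\<^sup>2 / 2) * prob {w\<in>space M. \<forall>k\<in>{1..n}. Y k w \<le> 1 / L - 4 / L * g k}"
    by (rule family_shift[OF fam _ Y1]) (use L in \<open>auto simp: g_def\<close>)
  also have "\<dots> \<le> exp 12 * (L * excess n)"
  proof (intro mult_mono)
    have "(4 / L)\<^sup>2 \<le> 4\<^sup>2" using L by (intro power_mono) (auto simp: field_simps)
    then show "exp (L * (4 / L) + (4 / L)\<^sup>2 / 2) \<le> exp 12" using L by simp
    \<comment> \<open>On \<open>E\<close> the maximum is at most \<open>- 1 / L\<close>, so the
      integrand of the excess is at least \<open>1 / L\<close> there.\<close>
    define E where "E = {w\<in>space M. \<forall>k\<in>{1..n}. Y k w \<le> 1 / L - 4 / L * g k}"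
    have [measurable]: "E \<in> sets M" unfolding E_def by measurable
    have "integrable M (\<lambda>w. 1 / L * indicator E w :: real)"
      by (intro integrable_mult_right integrable_real_indicator) (auto simp: emeasure_eq_measure)
    then have "(LINT w|M. 1 / L * indicator E w) \<le> excess n"
      unfolding excess_def
    proof (intro integral_mono integrable_excess \<open>n \<ge> 1\<close>)
      fix w assume w: "w \<in> space M"
      show "1 / L * indicator E w \<le> max 0 (- (MAX k\<in>{1..n}. Y k w))"
      proof (cases "w \<in> E")
        case True
        have "Y k w \<le> - 1 / L" if "k \<in> {1..n}" for k
        proof -
          have "Y k w \<le> 1 / L - 4 / L * g k" using True that by (simp add: E_def)
          also have "\<dots> \<le> 1 / L - 4 / L * (1 / 2)"
            using g[OF that] L by (intro diff_left_mono mult_left_mono) auto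
          finally show ?thesis by (simp add: field_simps)
        qed
        then have "(MAX k\<in>{1..n}. Y k w) \<le> - 1 / L"
          using \<open>n \<ge> 1\<close> by (subst Max_le_iff) auto
        then show ?thesis using True by simp
      qed simp
    qed
    then have "prob E / L \<le> excess n" by simp
    then show "prob {w\<in>space M. \<forall>k\<in>{1..n}. Y k w \<le> 1 / L - 4 / L * g k} \<le> L * excess n"
      using L by (simp add: E_def field_simps)
  qed auto
  also have "L * excess n \<le> L * (2 * L * real n powr (H - 1))"
    using L by (intro mult_left_mono excess_upper) auto
  finally have 1: "prob {w\<in>space M. (\<forall>k\<in>{1..n}. Y k w \<le> 1 / L) \<and> - L \<le> Y 1 w}
      \<le> 2 * exp 12 * L\<^sup>2 * real n powr (H - 1)"
    by (simp add: power2_eq_square mult_ac)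
  have gm: "gaussian_variable M (\<lambda>w. - Y 1 w)"
    using family_gaussian[OF fam[of "{1}"], of "\<lambda>_. - 1"] by simp
  have mm: "(LINT w|M. - Y 1 w) = 0" "(LINT w|M. (- Y 1 w)\<^sup>2) \<le> 1\<^sup>2"
    using Y_variance[of 1] by (simp_all add: Y_mean)
  have 2: "prob {w\<in>space M. L \<le> - Y 1 w} \<le> exp (- L\<^sup>2 / 2)"
    using gaussian_variable_tail[OF prob_space_axioms gm mm, of L] L by simp
  have "prob {w\<in>space M. \<forall>k\<in>{1..n}. Y k w \<le> 1 / L}
    \<le> prob ({w\<in>space M. (\<forall>k\<in>{1..n}. Y k w \<le> 1 / L) \<and> - L \<le> Y 1 w} \<union> {w\<in>space M. L \<le> - Y 1 w})"
    by (intro finite_measure_mono) auto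
  also have "\<dots> \<le> prob {w\<in>space M. (\<forall>k\<in>{1..n}. Y k w \<le> 1 / L) \<and> - L \<le> Y 1 w}
      + prob {w\<in>space M. L \<le> - Y 1 w}"
    by (intro measure_Un_le) auto
  finally show ?thesis using 1 2 by linarith
qed

end

section \<open>Persistence of the paths\<close>

lemma fbm_cov_scale:
  assumes "h > 0"
  shows "fbm_cov H (h * t) (h * s) = (h powr H)\<^sup>2 * fbm_cov H t s"
proof -
  have e: "h powr (2 * H) = (h powr H)\<^sup>2"
    by (simp add: powr_add[symmetric] power2_eq_square)
  have "fbm_cov H (h * t) (h * s) = h powr (2 * H) * fbm_cov H t s"
    using assms
    by (simp add: fbm_cov_def right_diff_distrib[symmetric] abs_mult powr_mult)
      (simp add: algebra_simps)
  then show ?thesis unfolding e .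
qed

text \<open>Dyadic points are dense and the path is continuous. The right-hand side is a countable
  conjunction, which later gives measurability of the persistence event.\<close>

lemma le_on_interval_iff_dyadic:
  fixes f :: "real \<Rightarrow> real"
  assumes f: "continuous_on {0..} f" and "h > 0"
  shows "(\<forall>t\<in>{0..h * real N}. f t \<le> a) \<longleftrightarrow> (\<forall>m j. j \<le> N * 2 ^ m \<longrightarrow> f (h * real j / 2 ^ m) \<le> a)"
proof safe
  fix m j assume *: "\<forall>t\<in>{0..h * real N}. f t \<le> a" "j \<le> N * 2 ^ m"
  then have "real j \<le> real (N * 2 ^ m)" by (simp only: of_nat_le_iff)
  then have "real j / 2 ^ m \<le> real N" by (simp add: field_simps)
  then have "h * (real j / 2 ^ m) \<le> h * real N" using \<open>h > 0\<close> by (intro mult_left_mono) auto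
  then show "f (h * real j / 2 ^ m) \<le> a" using *(1) \<open>h > 0\<close> by auto
next
  fix t assume *: "\<forall>m j. j \<le> N * 2 ^ m \<longrightarrow> f (h * real j / 2 ^ m) \<le> a" and t: "t \<in> {0..h * real N}"
  \<comment> \<open>Rounding down keeps the dyadic approximations of \<open>t\<close> inside the
    interval.\<close>
  define j where "j m = nat \<lfloor>t / h * 2 ^ m\<rfloor>" for m :: nat
  have t': "0 \<le> t / h" "t / h \<le> real N" using t \<open>h > 0\<close> by (auto simp: field_simps)
  have rj: "real (j m) = of_int \<lfloor>t / h * 2 ^ m\<rfloor>" for m
  proof -
    have "0 \<le> t / h * 2 ^ m" using t'(1) by (intro mult_nonneg_nonneg) auto
    then show ?thesis by (simp only: j_def of_nat_nat zero_le_floor)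
  qed
  have le: "real (j m) \<le> t / h * 2 ^ m" and ge: "t / h * 2 ^ m - 1 \<le> real (j m)" for m
    unfolding rj by linarith+
  have jN: "j m \<le> N * 2 ^ m" for m
  proof -
    have "real (j m) \<le> real N * 2 ^ m"
      using le[of m] mult_right_mono[OF t'(2), of "2 ^ m"] by simp
    also have "\<dots> = real (N * 2 ^ m)" by simp
    finally show ?thesis by (simp only: of_nat_le_iff)
  qed
  have lim: "(\<lambda>m. h * real (j m) / 2 ^ m) \<longlonglongrightarrow> t"
  proof (rule tendsto_sandwich)
    show "\<forall>\<^sub>F m in sequentially. t - h * (1 / 2) ^ m \<le> h * real (j m) / 2 ^ m"
    proof (intro always_eventually allI)
      fix m
      have "h / 2 ^ m * (t / h * 2 ^ m - 1) \<le> h / 2 ^ m * real (j m)"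
        using ge \<open>h > 0\<close> by (intro mult_left_mono) auto
      then show "t - h * (1 / 2) ^ m \<le> h * real (j m) / 2 ^ m"
        using \<open>h > 0\<close> by (simp add: right_diff_distrib power_divide)
    qed
    show "\<forall>\<^sub>F m in sequentially. h * real (j m) / 2 ^ m \<le> t"
      using le \<open>h > 0\<close> by (intro always_eventually) (auto simp: field_simps)
    have "(\<lambda>m. t - h * (1 / 2) ^ m) \<longlonglongrightarrow> t - h * 0"
      by (intro tendsto_intros LIMSEQ_power_zero) auto
    then show "(\<lambda>m. t - h * (1 / 2) ^ m) \<longlonglongrightarrow> t" by simp
  qed simp
  have "(\<lambda>m. f (h * real (j m) / 2 ^ m)) \<longlonglongrightarrow> f t"
    by (rule continuous_on_tendsto_compose[OF f lim]) (use t \<open>h > 0\<close> in auto)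
  then show "f t \<le> a"
    by (rule LIMSEQ_le_const2) (use * jN in auto)
qed

text \<open>A new point of level \<open>Suc m\<close> has an old point as its left neighbour, so
  only one upward increment is added per level. The allowances telescope:
  \<open>1 - r ^ Suc m + (1 - r) * r ^ Suc m = 1 - r ^ Suc (Suc m)\<close>.\<close>

lemma chaining_bound:
  fixes f :: "real \<Rightarrow> real"
  assumes r: "0 < r" "r < 1"
    and grid: "\<And>k. k \<le> N \<Longrightarrow> f (h * real k) \<le> 0"
    and incr: "\<And>m j. j < N * 2 ^ m \<Longrightarrow> f (h * real j / 2 ^ m + h / 2 ^ m) - f (h * real j / 2 ^ m) \<le> (1 - r) * r ^ m"
    and "j \<le> N * 2 ^ m"
  shows "f (h * real j / 2 ^ m) \<le> 1 - r ^ Suc m"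
  using \<open>j \<le> N * 2 ^ m\<close>
proof (induction m arbitrary: j)
  case 0
  then show ?case using grid[of j] r by simp
next
  case (Suc m)
  show ?case
  proof (cases "even j")
    case True
    then obtain i where i: "j = 2 * i" by auto
    then have "f (h * real i / 2 ^ m) \<le> 1 - r ^ Suc m" using Suc by simp
    also have "\<dots> \<le> 1 - r ^ Suc (Suc m)" using r power_decreasing[of "Suc m" "Suc (Suc m)" r] by simp
    finally show ?thesis using i by simp
  next
    case False
    then obtain i where i: "j = 2 * i + 1" using oddE by blast
    then have lt: "2 * i < N * 2 ^ Suc m" using Suc.prems by simp
    then have "i \<le> N * 2 ^ m" by simp
    then have "f (h * real i / 2 ^ m) \<le> 1 - r ^ Suc m" by (rule Suc.IH)
    moreover have "h * real (2 * i) / 2 ^ Suc m = h * real i / 2 ^ m" by simp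
    moreover have "h * real (2 * i) / 2 ^ Suc m + h / 2 ^ Suc m = h * real j / 2 ^ Suc m"
      by (simp add: i field_simps)
    ultimately show ?thesis using incr[OF lt] by (simp add: algebra_simps)
  qed
qed

section \<open>Estimates for the continuous-time process\<close>

context
  fixes H :: real and M :: "'a measure" and X :: "real \<Rightarrow> 'a \<Rightarrow> real"
  assumes H: "0 < H" "H < 1" and fbm: "fractional_brownian_motion H M X"
begin

lemma fbm_prob_space: "prob_space M"
  using fbm by (simp add: fractional_brownian_motion_def gaussian_process_def)

lemma fbm_family:
  assumes "finite J" "J \<subseteq> {0..}"
  shows "centered_gaussian_family M J X"
  using fbm assms fbm_prob_space
  by (auto simp: centered_gaussian_family_def fractional_brownian_motion_def gaussian_process_def)

lemma fbm_mult: "0 \<le> t \<Longrightarrow> 0 \<le> s \<Longrightarrow> (LINT w|M. X t w * X s w) = fbm_cov H t s"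
  using fbm by (simp add: fractional_brownian_motion_def fbm_cov_def)

lemma fbm_continuous: "w \<in> space M \<Longrightarrow> continuous_on {0..} (\<lambda>t. X t w)"
  using fbm by (simp add: fractional_brownian_motion_def)

lemma fbm_measurable: "0 \<le> t \<Longrightarrow> X t \<in> borel_measurable M"
  using family_measurable[OF fbm_family[of "{t}"], of t] by simp

lemma fbm_discrete:
  assumes "h > 0"
  shows "discrete_fbm H M (\<lambda>k w. X (h * real k) w / h powr H)"
proof
  fix I :: "nat set" assume "finite I"
  have J: "finite ((\<lambda>k. h * real k) ` I)" "(\<lambda>k. h * real k) ` I \<subseteq> {0..}"
    using \<open>finite I\<close> assms by auto
  have "(\<Sum>t\<in>(\<lambda>k. h * real k) ` I. of_bool (t = h * real k) / h powr H * X t w) = X (h * real k) w / h powr H"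
    if "k \<in> I" for k w
    using J(1) that
    by (auto simp add: of_bool_def if_distrib[of "\<lambda>x. x / _"] if_distrib[of "\<lambda>x. x * _"] cong: if_cong)
  then show "centered_gaussian_family M I (\<lambda>k w. X (h * real k) w / h powr H)"
    using family_linear_image[OF fbm_family[OF J] \<open>finite I\<close>, of "\<lambda>k t. of_bool (t = h * real k) / h powr H"]
    unfolding centered_gaussian_family_def by (simp cong: sum.cong)
next
  fix j k
  have "(LINT w|M. X (h * real j) w / h powr H * (X (h * real k) w / h powr H))
      = (LINT w|M. X (h * real j) w * X (h * real k) w / (h powr H)\<^sup>2)"
    by (simp add: power2_eq_square)
  also have "\<dots> = fbm_cov H (real j) (real k)"
    using assms by (simp add: fbm_mult fbm_cov_scale)
  finally show "(LINT w|M. X (h * real j) w / h powr H * (X (h * real k) w / h powr H))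
      = fbm_cov H (real j) (real k)" .
qed (use H in auto)

lemma fbm_increment_tail:
  assumes "0 \<le> t" "0 < e" "0 < y"
  shows "measure M {w\<in>space M. X (t + e) w - X t w \<ge> e powr H * y} \<le> exp (- y\<^sup>2 / 2)"
proof -
  have fam: "centered_gaussian_family M {t, t + e} X" by (rule fbm_family) (use assms in auto)
  define c where "c s = (if s = t then - 1 else 1 :: real)" for s
  have c: "(\<Sum>s\<in>{t, t + e}. c s * X s w) = X (t + e) w - X t w" for w
    using assms by (simp add: c_def)
  have g: "gaussian_variable M (\<lambda>w. X (t + e) w - X t w)" "(LINT w|M. X (t + e) w - X t w) = 0"
    using family_gaussian[OF fam, of c] family_combination_mean[OF fam, of c] unfolding c .
  have "(LINT w|M. (X (t + e) w - X t w)\<^sup>2) = e powr (2 * H)"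
    using family_combination_mult[OF fam, of c c] assms unfolding c
    by (simp add: fbm_mult fbm_cov_def c_def power2_eq_square field_simps)
  also have "\<dots> = (e powr H)\<^sup>2"
    by (simp add: powr_add[symmetric] power2_eq_square)
  finally have v: "(LINT w|M. (X (t + e) w - X t w)\<^sup>2) \<le> (e powr H)\<^sup>2" by simp
  show ?thesis
    by (rule gaussian_variable_tail[OF fbm_prob_space g v]) (use assms in auto)
qed

text \<open>Continuity on the compact interval bounds each path from above, so that its real
  \<open>SUP\<close> is a genuine least upper bound.\<close>

lemma sup_event:
  assumes "T > 0"
  shows "{w\<in>space M. (SUP t\<in>{0..T}. X t w) \<le> 1} = {w\<in>space M. \<forall>t\<in>{0..T}. X t w \<le> 1}"
proof -
  have "(SUP t\<in>{0..T}. X t w) \<le> 1 \<longleftrightarrow> (\<forall>t\<in>{0..T}. X t w \<le> 1)" if "w \<in> space M" for w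
  proof (rule cSUP_le_iff)
    have "continuous_on {0..T} (\<lambda>t. X t w)"
      using fbm_continuous[OF that] by (rule continuous_on_subset) auto
    then have "compact ((\<lambda>t. X t w) ` {0..T})" by (rule compact_continuous_image) simp
    then show "bdd_above ((\<lambda>t. X t w) ` {0..T})"
      by (intro bounded_imp_bdd_above compact_imp_bounded)
  qed (use assms in auto)
  then show ?thesis by blast
qed

text \<open>The grid points lie in \<open>{0..T}\<close>, and since \<open>h powr H = L\<close> the
  level \<open>1\<close> becomes \<open>1 / L\<close> after rescaling.\<close>

lemma persistence_upper:
  assumes "h > 0" and L: "1 \<le> L" "real n + 1 \<le> exp (L\<^sup>2 / 2)" "n \<ge> 1"
    and hL: "h powr H = L" and T: "h * real n \<le> T"
  shows "measure M {w\<in>space M. (SUP t\<in>{0..T}. X t w) \<le> 1}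
    \<le> 2 * exp 12 * L\<^sup>2 * real n powr (H - 1) + exp (- L\<^sup>2 / 2)"
proof -
  interpret discrete_fbm H M "\<lambda>k w. X (h * real k) w / h powr H"
    by (rule fbm_discrete) fact
  have "h * 1 \<le> h * real n" using L \<open>h > 0\<close> by (intro mult_left_mono) auto
  then have "T > 0" using T \<open>h > 0\<close> by linarith
  have "measure M {w\<in>space M. (SUP t\<in>{0..T}. X t w) \<le> 1}
    \<le> prob {w\<in>space M. \<forall>k\<in>{1..n}. X (h * real k) w / h powr H \<le> 1 / L}"
  proof (intro finite_measure_mono)
    show "{w\<in>space M. (SUP t\<in>{0..T}. X t w) \<le> 1}
      \<subseteq> {w\<in>space M. \<forall>k\<in>{1..n}. X (h * real k) w / h powr H \<le> 1 / L}"
      unfolding sup_event[OF \<open>T > 0\<close>] hL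
    proof safe
      fix w k assume w: "\<forall>t\<in>{0..T}. X t w \<le> 1" and k: "k \<in> {1..n}"
      have "h * real k \<le> h * real n" using k \<open>h > 0\<close> by (intro mult_left_mono) auto
      then have "h * real k \<le> T" using T by linarith
      then have "X (h * real k) w \<le> 1" using w \<open>h > 0\<close> by simp
      then show "X (h * real k) w / L \<le> 1 / L" using L by (simp add: divide_right_mono)
    qed
    show "{w\<in>space M. \<forall>k\<in>{1..n}. X (h * real k) w / h powr H \<le> 1 / L} \<in> events"
      using Y_measurable by measurable
  qed
  also have "\<dots> \<le> 2 * exp 12 * L\<^sup>2 * real n powr (H - 1) + exp (- L\<^sup>2 / 2)"
    by (rule prob_le_upper[OF L])
  finally show ?thesis .
qed

text \<open>If the grid values are nonpositive and no dyadic increment is too large, chaining keeps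
  the path below \<open>1\<close>. The value of \<open>r\<close> makes the allowed increments shrink
  like \<open>2 powr (- m * H / 2)\<close>, more slowly than their standard deviations
  \<open>h powr H * 2 powr (- m * H)\<close>.\<close>

lemma persistence_lower:
  assumes "h > 0" and L: "1 \<le> L" "real N + 1 \<le> exp (L\<^sup>2 / 2)" "N \<ge> 1" and K: "12 * L \<le> real K powr H"
    and r: "r = 2 powr (- (H / 2))" and A: "A = ((1 - r) / h powr H)\<^sup>2 / 2" "A * H \<ge> 2"
  shows "2 * real N powr (H - 1) / real K - exp (- L\<^sup>2 / 2) - 2 * real N * exp (- A)
    \<le> measure M {w\<in>space M. (SUP t\<in>{0..h * real N}. X t w) \<le> 1}"
proof -
  interpret discrete_fbm H M "\<lambda>k w. X (h * real k) w / h powr H"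
    by (rule fbm_discrete) fact
  have [measurable]: "X 0 \<in> borel_measurable M" "X (h * real j / 2 ^ m) \<in> borel_measurable M"
    "X (h * real j / 2 ^ m + h / 2 ^ m) \<in> borel_measurable M" for j m
    using \<open>h > 0\<close> by (auto intro!: fbm_measurable)
  have r01: "0 < r" "r < 1" using H by (auto simp: r powr_less_one)
  define T where "T = h * real N"
  have "T > 0" using L \<open>h > 0\<close> by (simp add: T_def)
  define E where "E = {w\<in>space M. (SUP t\<in>{0..T}. X t w) \<le> 1}"
  define G where "G = {w\<in>space M. \<forall>k\<in>{1..N}. X (h * real k) w / h powr H \<le> 0}"
  \<comment> \<open>The grid event starts at index \<open>1\<close>; time \<open>0\<close> is
    handled by this event, which is null because \<open>X 0\<close> has variance zero.\<close>
  define Z where "Z = {w\<in>space M. 0 < X 0 w}"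
  define B where "B m = (\<Union>j\<in>{..<N * 2 ^ m}. {w\<in>space M. X (h * real j / 2 ^ m + h / 2 ^ m) w - X (h * real j / 2 ^ m) w \<ge> (1 - r) * r ^ m})" for m
  have E: "E = {w\<in>space M. \<forall>m j. j \<le> N * 2 ^ m \<longrightarrow> X (h * real j / 2 ^ m) w \<le> 1}"
    unfolding E_def sup_event[OF \<open>T > 0\<close>]
    using le_on_interval_iff_dyadic[OF fbm_continuous \<open>h > 0\<close>, of _ N 1] by (auto simp: T_def)
  have Em[measurable]: "E \<in> events"
    unfolding E by measurable
  have Bm[measurable]: "B m \<in> events" for m
    unfolding B_def by measurable
  have Gm[measurable]: "G \<in> events" unfolding G_def using Y_measurable by measurable
  have Zm[measurable]: "Z \<in> events" unfolding Z_def by measurable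
  have "G \<subseteq> E \<union> (Z \<union> (\<Union>m. B m))"
  proof
    fix w assume w: "w \<in> G"
    show "w \<in> E \<union> (Z \<union> (\<Union>m. B m))"
    proof (cases "w \<in> Z \<union> (\<Union>m. B m)")
      case False
      have ws: "w \<in> space M" using w by (simp add: G_def)
      have "X (h * real j / 2 ^ m) w \<le> 1 - r ^ Suc m" if "j \<le> N * 2 ^ m" for m j
      proof (rule chaining_bound[OF r01 _ _ that])
        fix k assume "k \<le> N"
        show "X (h * real k) w \<le> 0"
        proof (cases "k = 0")
          case True
          then show ?thesis using False ws by (auto simp: Z_def)
        next
          case k: False
          have "X (h * real k) w / h powr H \<le> 0" using w k \<open>k \<le> N\<close> by (auto simp: G_def)
          then show ?thesis using \<open>h > 0\<close> by (simp add: divide_le_0_iff)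
        qed
      next
        fix m j assume "j < N * 2 ^ m"
        then show "X (h * real j / 2 ^ m + h / 2 ^ m) w - X (h * real j / 2 ^ m) w \<le> (1 - r) * r ^ m"
        proof -
          have "w \<notin> B m" using False by blast
          then have "\<not> (1 - r) * r ^ m \<le> X (h * real j / 2 ^ m + h / 2 ^ m) w - X (h * real j / 2 ^ m) w"
            unfolding B_def using \<open>j < N * 2 ^ m\<close> ws by blast
          then show ?thesis by linarith
        qed
      qed
      then have "X (h * real j / 2 ^ m) w \<le> 1" if "j \<le> N * 2 ^ m" for m j
        using that r01 by (smt (verit) zero_le_power)
      then show ?thesis using ws by (auto simp: E)
    qed simp
  qed
  then have "prob G \<le> prob (E \<union> (Z \<union> (\<Union>m. B m)))"
    by (intro finite_measure_mono) auto
  also have "\<dots> \<le> prob E + (prob Z + prob (\<Union>m. B m))"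
    by (intro order_trans[OF measure_Un_le] add_mono order_refl) auto
  also have "prob Z = 0"
  proof -
    have "(LINT w|M. (X 0 w)\<^sup>2) = 0" using fbm_mult[of 0 0] by (simp add: fbm_cov_def power2_eq_square)
    moreover have "integrable M (\<lambda>w. (X 0 w)\<^sup>2)"
      using family_integrable_mult[OF fbm_family[of "{0}"], of 0 0] by (simp add: power2_eq_square)
    ultimately have "AE w in M. (X 0 w)\<^sup>2 = 0"
      by (subst (asm) integral_nonneg_eq_0_iff_AE) auto
    then show ?thesis
      by (subst prob_eq_0) (auto simp: Z_def)
  qed
  also have "prob (\<Union>m. B m) \<le> (\<Sum>m. real N * exp (- A) * (1 / 2) ^ m)"
  proof -
    have Bb: "prob (B m) \<le> real N * exp (- A) * (1 / 2) ^ m" for m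
    proof -
      define q :: real where "q = 2 powr (real m * H / 2)"
      have q: "q > 0" by (simp add: q_def)
      \<comment> \<open>\<open>y\<close> is the allowed increment at level \<open>m\<close> measured
        in standard deviations; it grows like \<open>q\<close>.\<close>
      define y where "y = (1 - r) / h powr H * q"
      have y: "y > 0" using r01 \<open>h > 0\<close> q by (simp add: y_def)
      have "r ^ m = r powr real m" using r01 by (simp add: powr_realpow)
      also have "\<dots> = inverse q"
        unfolding r q_def powr_powr powr_minus[symmetric]
        by (rule arg_cong[where f="\<lambda>x. 2 powr x"]) simp
      finally have rm: "r ^ m = inverse q" .
      have "h / 2 ^ m = h * 2 powr (- real m)"
        by (simp add: powr_minus powr_realpow divide_inverse)
      then have "(h / 2 ^ m) powr H = h powr H * (2 powr (- real m)) powr H"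
        using \<open>h > 0\<close> by (simp only: powr_mult)
      also have "(2 powr (- real m)) powr H = inverse q * inverse q"
        unfolding q_def powr_powr powr_minus[symmetric] powr_add[symmetric]
        by (rule arg_cong[where f="\<lambda>x. 2 powr x"]) simp
      finally have hq: "(h / 2 ^ m) powr H = h powr H * (inverse q * inverse q)" .
      have "h powr H > 0" using \<open>h > 0\<close> by simp
      then have th: "(h / 2 ^ m) powr H * y = (1 - r) * r ^ m"
        unfolding hq y_def rm using q by (simp add: field_simps)
      have "y\<^sup>2 / 2 = A * q\<^sup>2"
        unfolding y_def A(1) power_mult_distrib by simp
      also have "q\<^sup>2 = 2 powr (real m * H)"
        unfolding q_def power2_eq_square powr_add[symmetric]
        by (rule arg_cong[where f="\<lambda>x. 2 powr x"]) simp
      also have "\<dots> = exp (real m * H * ln 2)" by (simp add: powr_def)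
      finally have "y\<^sup>2 / 2 = A * exp (real m * H * ln 2)" .
      \<comment> \<open>Linearising the exponential suffices: \<open>A * H \<ge> 2\<close> gives a
        factor \<open>(1 / 4) ^ m\<close>, which beats the \<open>N * 2 ^ m\<close> increments of
        level \<open>m\<close> and leaves a geometric series.\<close>
      moreover have "A * (1 + real m * H * ln 2) \<le> A * exp (real m * H * ln 2)"
        by (intro mult_left_mono exp_ge_add_one_self) (simp add: A(1))
      moreover have "A * (1 + real m * H * ln 2) = A + (A * H) * (real m * ln 2)"
        by (simp add: algebra_simps)
      moreover have "2 * (real m * ln 2) \<le> (A * H) * (real m * ln 2)"
        using A(2) by (intro mult_right_mono) auto
      ultimately have "- y\<^sup>2 / 2 \<le> - A + - (2 * (real m * ln 2))" by linarith
      then have "exp (- y\<^sup>2 / 2) \<le> exp (- A) * exp (- (2 * (real m * ln 2)))"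
        unfolding exp_add[symmetric] exp_le_cancel_iff .
      also have "exp (- (2 * (real m * ln 2))) = (1 / 4) ^ m"
      proof -
        have "ln (4::real) = 2 * ln 2" using ln_realpow[of "2::real" 2] by simp
        then have "- (2 * (real m * ln 2)) = real m * (- ln (4::real))" by simp
        then show ?thesis by (simp only: exp_of_nat_mult) (simp add: exp_minus inverse_eq_divide)
      qed
      finally have tail: "exp (- y\<^sup>2 / 2) \<le> exp (- A) * (1 / 4) ^ m" .
      have "prob (B m) \<le> (\<Sum>j\<in>{..<N * 2 ^ m}. prob {w\<in>space M. X (h * real j / 2 ^ m + h / 2 ^ m) w - X (h * real j / 2 ^ m) w \<ge> (1 - r) * r ^ m})"
        unfolding B_def by (intro measure_UNION_le) auto
      also have "\<dots> \<le> (\<Sum>j\<in>{..<N * 2 ^ m}. exp (- A) * (1 / 4) ^ m)"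
        unfolding th[symmetric] using \<open>h > 0\<close> y
        by (intro sum_mono order_trans[OF fbm_increment_tail tail]) auto
      also have "\<dots> = real N * exp (- A) * (2 ^ m * (1 / 4) ^ m)" by simp
      also have "2 ^ m * (1 / 4) ^ m = (1 / 2 :: real) ^ m" by (simp flip: power_mult_distrib)
      finally show ?thesis .
    qed
    have sm: "summable (\<lambda>m. real N * exp (- A) * (1 / 2) ^ m)"
      by (intro summable_mult summable_geometric) simp
    have sB: "summable (\<lambda>m. prob (B m))"
      by (rule summable_comparison_test'[OF sm]) (use Bb in auto)
    have "prob (\<Union>m. B m) \<le> (\<Sum>m. prob (B m))"
      by (rule finite_measure_subadditive_countably) (use sB in auto)
    also have "\<dots> \<le> (\<Sum>m. real N * exp (- A) * (1 / 2) ^ m)"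
      by (rule suminf_le[OF Bb sB sm])
    finally show ?thesis .
  qed
  also have "(\<Sum>m. real N * exp (- A) * (1 / 2) ^ m) = 2 * real N * exp (- A)"
    by (subst suminf_mult) (auto intro: summable_geometric simp: suminf_geometric)
  finally have "prob G \<le> prob E + (0 + 2 * real N * exp (- A))" by simp
  moreover have "2 * real N powr (H - 1) / real K - exp (- L\<^sup>2 / 2) \<le> prob G"
    unfolding G_def by (rule prob_nonpos_lower[OF L K])
  ultimately show ?thesis unfolding E_def T_def by simp
qed

end

section \<open>Choice of mesh and truncation level\<close>

lemma fbm_persistence_upper:
  assumes H: "0 < H" "H < 1" and fbm: "fractional_brownian_motion H M X"
  shows "\<forall>\<^sub>F T in at_top. measure M {w\<in>space M. (SUP t\<in>{0..T}. X t w) \<le> 1}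
    \<le> T powr (- (1 - H)) * (ln T) powr (2 + 1 / H)"
proof -
  define g where "g = 1 / H"
  have g: "g > 0" using H by (simp add: g_def)
  \<comment> \<open>The factors \<open>L\<^sup>2\<close> and \<open>h\<close> are of order
    \<open>ln T\<close> and \<open>ln T powr (g / 2)\<close>, so the exponent \<open>2 + g\<close>
    leaves room for the constants and for the error \<open>T powr (-2)\<close>.\<close>
  have "\<forall>\<^sub>F T in at_top. 2 * exp 12 * (2 * sqrt (ln T))\<^sup>2 * (2 * (2 * sqrt (ln T)) powr g) * T powr (H - 1)
      + exp (- 2 * ln T) \<le> T powr (H - 1) * (ln T) powr (2 + g)"
    using H g by real_asymp
  moreover have "\<forall>\<^sub>F T in at_top. (2 * sqrt (ln T)) powr g \<le> T"
    using H g by real_asymp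
  moreover have "\<forall>\<^sub>F T :: real in at_top. ln T \<ge> 1"
    by real_asymp
  moreover have "\<forall>\<^sub>F T in at_top. T \<ge> (2 :: real)"
    by real_asymp
  ultimately show ?thesis
  proof eventually_elim
    case (elim T)
    \<comment> \<open>With this choice \<open>exp (L\<^sup>2 / 2)\<close> is
      \<open>T\<^sup>2\<close>, which dominates \<open>n + 1\<close> and makes the Gaussian error
      \<open>T powr (-2)\<close>.\<close>
    define L where "L = 2 * sqrt (ln T)"
    define h where "h = L powr g"
    define n where "n = nat \<lfloor>T / h\<rfloor>"
    have "1 \<le> sqrt (ln T)" using elim by simp
    then have "1 \<le> L" unfolding L_def by linarith
    moreover have "L\<^sup>2 / 2 = 2 * ln T" using elim by (simp add: L_def power_mult_distrib)
    ultimately have L: "1 \<le> L" "L\<^sup>2 / 2 = 2 * ln T" .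
    have h: "h \<ge> 1" "h \<le> T" "h > 0"
      using L(1) g elim(2) by (auto simp: h_def L_def[symmetric] ge_one_powr_ge_zero)
    have hL: "h powr H = L" using L(1) H by (simp add: h_def g_def powr_powr)
    have x: "1 \<le> T / h" using h by simp
    have n: "real n = of_int \<lfloor>T / h\<rfloor>" using x by (simp add: n_def)
    have "n \<ge> 1" using x by (simp add: n_def le_nat_iff)
    have nle: "real n \<le> T / h" unfolding n by linarith
    have "x / 2 \<le> of_int \<lfloor>x\<rfloor>" if "1 \<le> x" for x :: real
    proof -
      have "1 \<le> \<lfloor>x\<rfloor>" using that by simp
      then show ?thesis by linarith
    qed
    with x have nge: "T / h / 2 \<le> real n" unfolding n by blast
    have "T / h \<le> T" using h elim by (simp add: field_simps)
    then have "real n + 1 \<le> T + 1" using nle by linarith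
    also have "\<dots> \<le> 2 * T" using elim by simp
    also have "\<dots> \<le> T * T" using elim by (intro mult_right_mono) auto
    also have "\<dots> = exp (L\<^sup>2 / 2)" using elim unfolding L(2) by (simp add: exp_double power2_eq_square)
    finally have nexp: "real n + 1 \<le> exp (L\<^sup>2 / 2)" .
    have "h * real n \<le> T" using nle h by (simp add: field_simps)
    then have "measure M {w\<in>space M. (SUP t\<in>{0..T}. X t w) \<le> 1}
        \<le> 2 * exp 12 * L\<^sup>2 * real n powr (H - 1) + exp (- L\<^sup>2 / 2)"
      by (intro persistence_upper[OF H fbm, of h] h L nexp \<open>n \<ge> 1\<close> hL)
    \<comment> \<open>The exponent is negative, so \<open>n \<ge> T / (2 * h)\<close> gives an upper
      bound; then \<open>(2 * h) powr (1 - H)\<close> is simplified to \<open>2 * h\<close>.\<close>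
    also have "real n powr (H - 1) \<le> (2 * h) * T powr (H - 1)"
    proof -
      have "real n powr (H - 1) \<le> (T / h / 2) powr (H - 1)"
        using nge x H by (intro powr_mono2') auto
      also have "\<dots> = T powr (H - 1) * (2 * h) powr (1 - H)"
        using h elim powr_minus_divide[of "2 * h" "1 - H"]
        by (simp add: powr_divide powr_mult powr_diff field_simps)
      also have "\<dots> \<le> T powr (H - 1) * (2 * h) powr 1"
        using h H by (intro mult_left_mono powr_mono) auto
      finally show ?thesis using h by (simp add: mult_ac)
    qed
    also have "exp (- L\<^sup>2 / 2) = exp (- 2 * ln T)" using L(2) by simp
    finally have "measure M {w\<in>space M. (SUP t\<in>{0..T}. X t w) \<le> 1}
        \<le> 2 * exp 12 * L\<^sup>2 * (2 * h * T powr (H - 1)) + exp (- 2 * ln T)"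
      by (simp add: mult_left_mono)
    also have "\<dots> \<le> T powr (H - 1) * ln T powr (2 + g)"
      using elim(1) by (simp add: h_def L_def mult.assoc)
    finally show ?case by (simp add: g_def)
  qed
qed

lemma fbm_persistence_lower:
  assumes H: "0 < H" "H < 1" and fbm: "fractional_brownian_motion H M X"
  shows "\<forall>\<^sub>F T in at_top. T powr (- (1 - H)) * (ln T) powr (- (2 + 1 / H))
    \<le> measure M {w\<in>space M. (SUP t\<in>{0..T}. X t w) \<le> 1}"
proof -
  define g where "g = 1 / H"
  define r where "r = (2::real) powr (- (H / 2))"
  \<comment> \<open>Chosen so that \<open>h powr H \<le> 1 / (b * L)\<close> becomes
    \<open>(1 - r) / h powr H \<ge> 2 * L\<close>, whence
    \<open>A \<ge> 2 * L\<^sup>2 = 8 * ln T\<close>.\<close>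
  define b where "b = 2 / (1 - r)"
  have r: "0 < r" "r < 1" using H by (auto simp: r_def powr_less_one)
  have b: "b \<ge> 1" using r by (simp add: b_def field_simps)
  have g: "g > 0" using H by (simp add: g_def)
  \<comment> \<open>The losses from the mesh and from \<open>K\<close> are each of order
    \<open>ln T powr (g / 2)\<close>. The summand \<open>T powr (- 1 / 2)\<close> reserves room for
    the Gaussian and chaining errors, bounded in the next estimate.\<close>
  have "\<forall>\<^sub>F T in at_top. ln T powr (- (2 + g)) + T powr (- 1 / 2)
      \<le> 2 / (2 * (b * (2 * sqrt (ln T))) powr g) / (2 * (12 * (2 * sqrt (ln T))) powr g)"
    using g b by real_asymp
  moreover have "\<forall>\<^sub>F T in at_top. exp (- 2 * ln T) + 2 * T\<^sup>2 * exp (- 8 * ln T) \<le> T powr (H - 1) * T powr (- 1 / 2)"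
    using H by real_asymp
  moreover have "\<forall>\<^sub>F T in at_top. T * (b * (2 * sqrt (ln T))) powr g + 2 \<le> T\<^sup>2"
    using g b by real_asymp
  moreover have "\<forall>\<^sub>F T in at_top. 8 * ln T * H \<ge> 2"
    using H by real_asymp
  moreover have "\<forall>\<^sub>F T :: real in at_top. ln T \<ge> 1"
    by real_asymp
  moreover have "\<forall>\<^sub>F T in at_top. T \<ge> (2 :: real)"
    by real_asymp
  ultimately show ?thesis
  proof eventually_elim
    case (elim T)
    define L where "L = 2 * sqrt (ln T)"
    define s where "s = (b * L) powr g"
    define K0 where "K0 = (12 * L) powr g"
    define N where "N = nat \<lceil>T * s\<rceil>"
    define K where "K = nat \<lceil>K0\<rceil>"
    \<comment> \<open>The mesh is adjusted after rounding \<open>N\<close> up, so that the grid ends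
      exactly at \<open>T\<close>; about \<open>s\<close> grid points fall in each unit of
      time.\<close>
    define h where "h = T / real N"
    define A where "A = ((1 - r) / h powr H)\<^sup>2 / 2"
    have "1 \<le> sqrt (ln T)" using elim by simp
    then have "1 \<le> L" unfolding L_def by linarith
    moreover have "L\<^sup>2 / 2 = 2 * ln T" using elim by (simp add: L_def power_mult_distrib)
    ultimately have L: "1 \<le> L" "L\<^sup>2 / 2 = 2 * ln T" .
    have bL: "1 \<le> b * L" using mult_mono[of 1 b 1 L] b L by simp
    have s: "1 \<le> s" unfolding s_def using bL g by (intro ge_one_powr_ge_zero) auto
    have K0: "1 \<le> K0" unfolding K0_def using L g by (intro ge_one_powr_ge_zero) auto
    have Ts: "2 \<le> T * s" using mult_mono[of 2 T 1 s] s elim by simp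
    have N: "real N = of_int \<lceil>T * s\<rceil>" using Ts by (simp add: N_def)
    have K: "real K = of_int \<lceil>K0\<rceil>" using K0 by (simp add: K_def)
    have N1: "T * s \<le> real N" "real N \<le> T * s + 1" "real N \<le> T * (2 * s)"
      unfolding N using Ts by linarith+
    have K1: "K0 \<le> real K" "real K \<le> 2 * K0" unfolding K using K0 by linarith+
    have "N \<ge> 1" using N1(1) Ts by linarith
    have h: "h > 0" using elim \<open>N \<ge> 1\<close> by (simp add: h_def)
    have hN: "h * real N = T" using \<open>N \<ge> 1\<close> by (simp add: h_def)
    have NT: "real N + 1 \<le> T\<^sup>2" using N1(2) elim(3) by (simp add: s_def L_def)
    also have "\<dots> = exp (L\<^sup>2 / 2)" using elim unfolding L(2) by (simp add: exp_double)
    finally have Nexp: "real N + 1 \<le> exp (L\<^sup>2 / 2)" .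
    have KL: "12 * L \<le> real K powr H"
    proof -
      have "12 * L = K0 powr H" using L H by (simp add: K0_def g_def powr_powr)
      also have "\<dots> \<le> real K powr H" using K1 K0 H by (intro powr_mono2) auto
      finally show ?thesis .
    qed
    have A8: "8 * ln T \<le> A"
    proof -
      have "h \<le> 1 / s" using N1(1) s \<open>N \<ge> 1\<close> by (simp add: h_def field_simps)
      then have "h powr H \<le> (1 / s) powr H" using h H by (intro powr_mono2) auto
      also have "\<dots> = 1 / (b * L)"
        using bL H s by (simp add: powr_divide s_def g_def powr_powr)
      also have "\<dots> = (1 - r) / (2 * L)" by (simp add: b_def)
      finally have "2 * L * h powr H \<le> 1 - r" using L by (simp add: field_simps)
      then have "2 * L \<le> (1 - r) / h powr H" using h by (simp add: field_simps)
      then have "(2 * L)\<^sup>2 \<le> ((1 - r) / h powr H)\<^sup>2" using L by (intro power_mono) auto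
      then show ?thesis using L(2) by (simp add: A_def power_mult_distrib)
    qed
    have "2 \<le> 8 * ln T * H" by fact
    also have "\<dots> \<le> A * H" using A8 H by (intro mult_right_mono) auto
    finally have AH: "2 \<le> A * H" .
    \<comment> \<open>Here the negative exponent calls for the upper bound
      \<open>N \<le> T * (2 * s)\<close>, and \<open>(2 * s) powr (H - 1)\<close> is replaced by the
      smaller \<open>1 / (2 * s)\<close>.\<close>
    have "T powr (H - 1) * (2 / (2 * s) / (2 * K0)) \<le> 2 * real N powr (H - 1) / real K"
    proof -
      have "(2 * s) powr (- 1) = 1 / (2 * s)"
        using s powr_minus_divide[of "2 * s" 1] by simp
      then have "T powr (H - 1) / (2 * s) = T powr (H - 1) * (2 * s) powr (- 1)"
        by (simp only: mult_1_right times_divide_eq_right)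
      also have "\<dots> \<le> T powr (H - 1) * (2 * s) powr (H - 1)"
        using s H by (intro mult_left_mono powr_mono) auto
      also have "\<dots> = (T * (2 * s)) powr (H - 1)"
        using s elim by (simp add: powr_mult)
      also have "\<dots> \<le> real N powr (H - 1)"
        using N1(3) \<open>N \<ge> 1\<close> H by (intro powr_mono2') auto
      finally have "2 * (T powr (H - 1) / (2 * s)) / (2 * K0) \<le> 2 * real N powr (H - 1) / real K"
        using K1 K0 by (intro frac_le mult_left_mono) auto
      then show ?thesis by simp
    qed
    moreover have "T powr (H - 1) * (ln T powr (- (2 + g)) + T powr (- 1 / 2))
        \<le> T powr (H - 1) * (2 / (2 * s) / (2 * K0))"
      using elim(1) unfolding s_def K0_def L_def by (intro mult_left_mono) auto
    moreover have "exp (- L\<^sup>2 / 2) + 2 * real N * exp (- A) \<le> T powr (H - 1) * T powr (- 1 / 2)"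
    proof -
      have "2 * real N * exp (- A) \<le> 2 * T\<^sup>2 * exp (- 8 * ln T)"
        using A8 NT by (intro mult_mono) auto
      moreover have "exp (- L\<^sup>2 / 2) = exp (- 2 * ln T)" using L(2) by simp
      ultimately show ?thesis using elim(2) by linarith
    qed
    moreover have "2 * real N powr (H - 1) / real K - exp (- L\<^sup>2 / 2) - 2 * real N * exp (- A)
        \<le> measure M {w\<in>space M. (SUP t\<in>{0..T}. X t w) \<le> 1}"
      using persistence_lower[OF H fbm h L(1) Nexp \<open>N \<ge> 1\<close> KL r_def A_def AH] by (simp only: hN)
    ultimately have "T powr (H - 1) * ln T powr (- (2 + g))
        \<le> measure M {w\<in>space M. (SUP t\<in>{0..T}. X t w) \<le> 1}"
      unfolding distrib_left by linarith
    then show ?case by (simp add: g_def)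
  qed
qed

theorem theorem1:
  fixes H :: real and M :: "'a measure" and X :: "real \<Rightarrow> 'a \<Rightarrow> real"
  assumes "0 < H" and "H < 1"
    and "fractional_brownian_motion H M X"
  shows "\<exists>c>0. \<forall>\<^sub>F T in at_top.
           T powr (- (1 - H)) * (ln T) powr (- c)
             \<le> measure M {w \<in> space M. (SUP t\<in>{0..T}. X t w) \<le> 1} \<and>
           measure M {w \<in> space M. (SUP t\<in>{0..T}. X t w) \<le> 1}
             \<le> T powr (- (1 - H)) * (ln T) powr c"
proof (intro exI[of _ "2 + 1 / H"] conjI)
  show "0 < 2 + 1 / H" using assms(1) by (simp add: add_pos_pos)
qed (intro eventually_conj fbm_persistence_lower fbm_persistence_upper assms)

end
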